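(* Let $n\ge2$, $\boldsymbol\lambda\in\mathbb C^n$ with $\sum_l\lambda_l=0$, $\mathfrak C=\max_l|\lambda_l|+1$, and let $\boldsymbol\varsigma\in\{+,-\}^n$ be such that the signs $\varsigma_1,\dots,\varsigma_n$ are not all equal (i.e. $J(x;\boldsymbol\varsigma,\boldsymbol\lambda)$ is a $K$-Bessel function). Then, for every integer $j\ge0$ and all $x\gg_n\mathfrak C^2$ (that is, $x\geq c_n\mathfrak C^2$ for a constant $c_n$ depending only on $n$), $$J^{(j)}(x;\boldsymbol\varsigma,\boldsymbol\lambda)\ll_{j,n}x^{-\frac{n-1}2}e^{-\pi\,\mathrm{Im}\,\Lambda(\boldsymbol\varsigma,\boldsymbol\lambda)-nI(\boldsymbol\varsigma)x},$$ where $\Lambda(\boldsymbol\varsigma,\boldsymbol\lambda)=\mp\sum_{l\in L_\pm(\boldsymbol\varsigma)}\lambda_l$ and $I(\boldsymbol\varsigma)=\sin\big(\frac{n_\pm(\boldsymbol\varsigma)}n\pi\big)>0$ (upper and lower signs give the same values), with $L_\pm(\boldsymbol\varsigma)=\{l:\varsigma_l=\pm\}$, $n_\pm(\boldsymbol\varsigma)=|L_\pm(\boldsymbol\varsigma)|$. In particular, $$J^{(j)}(x;\boldsymbol\varsigma,\boldsymbol\lambda)\ll_{j,n}x^{-\frac{n-1}2}e^{\pi\mathfrak I-n\sin(\frac1n\pi)x}$$ for all $K$-Bessel functions $J(x;\boldsymbol\varsigma,\boldsymbol\lambda)$ with given $\boldsymbol\lambda$, where $\mathfrak I=\max_l|\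mathrm{Im}\,\lambda_l|$.
   Context: Notation: $e(w)=e^{2\pi iw}$, $\mathbb N=\{0,1,\dots\}$; $\ll_{j,n}$ means the implied constant depends only on $j,n$. For $x>0$, $$J(x;\boldsymbol\varsigma,\boldsymbol\lambda)=\frac1{2\pi i}\int_{\mathcal C}\prod_{l=1}^n\Gamma(s-\lambda_l)\,e\Big(\frac{\varsigma_l(s-\lambda_l)}4\Big)\,x^{-ns}ds,$$ where $\mathcal C$ is any contour going upward from $\sigma-i\infty$ to $\sigma+i\infty$ with $\sigma<\frac12+\frac1n(\mathrm{Re}\sum_l\lambda_l-1)$, having all the sets $\lambda_l-\mathbb N$ on its left, and with $\mathrm{Re}\,s=\sigma$ for $s\in\mathcal C$ with $|\mathrm{Im}\,s|$ large. *)

theory Defs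
  imports "HOL-Analysis.Analysis"
begin

text \<open>
  Vectors of length \<open>n\<close> are functions on \<open>{1..n}\<close>; a sign vector is a function
  \<open>sg\<close> with \<open>sg l \<in> {1, -1}\<close> for \<open>l \<in> {1..n}\<close>.
\<close>

definition e :: "complex \<Rightarrow> complex" where
  "e w = exp (2 * of_real pi * \<i> * w)"

text \<open>
  For a simple curve \<open>\<gamma>\<close> going upward from \<open>\<sigma> - i \<infinity>\<close> to \<open>\<sigma> + i \<infinity>\<close>, the complement of the
  curve has two components, and its left side is the one that contains the far end
  of the negative real axis.  The same description is used if \<open>\<gamma>\<close> is not
  simple: points inside loops of \<open>\<gamma>\<close> do not count as lying on the left.
\<close>

definition left_side :: "(real \<Rightarrow> complex) \<Rightarrow> complex set" where
  "left_side \<gamma> =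
     {z. \<forall>\<^sub>F r in at_bot. connected_component (- range \<gamma>) z (complex_of_real r)}"

text \<open>
  The contours are parametrised over the real line, in such a way that the two vertical
  ends are parametrised by the imaginary part.
\<close>

definition bessel_contour :: "nat \<Rightarrow> (nat \<Rightarrow> complex) \<Rightarrow> (real \<Rightarrow> complex) \<Rightarrow> bool" where
  "bessel_contour n lam \<gamma> \<longleftrightarrow>
     (\<forall>a b. \<gamma> piecewise_C1_differentiable_on {a..b}) \<and>
     (\<exists>\<sigma> T. \<sigma> < 1/2 + 1 / real n * (Re (\<Sum>l=1..n. lam l) - 1) \<and>
            (\<forall>t. \<bar>t\<bar> \<ge> T \<longrightarrow> \<gamma> t = Complex \<sigma> t)) \<and>
     (\<forall>l\<in>{1..n}. \<forall>k::nat. lam l - of_nat k \<in> left_side \<gamma>)"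

text \<open>
  The integral along \<open>\<gamma>\<close> is the Henstock--Kurzweil integral over the real line, just
  as \<open>contour_integral\<close> in HOL-Complex-Analysis is one over the unit interval.
\<close>

definition bessel_J ::
    "nat \<Rightarrow> (nat \<Rightarrow> int) \<Rightarrow> (nat \<Rightarrow> complex) \<Rightarrow> (real \<Rightarrow> complex) \<Rightarrow> real \<Rightarrow> complex" where
  "bessel_J n sg lam \<gamma> x =
     1 / (2 * of_real pi * \<i>) *
     integral UNIV (\<lambda>t.
       (\<Prod>l=1..n. Gamma (\<gamma> t - lam l) * e (of_int (sg l) * (\<gamma> t - lam l) / 4)) *
       complex_of_real x powr (- of_nat n * \<gamma> t) *
       vector_derivative \<gamma> (at t))"

definition nth_derivative :: "nat \<Rightarrow> (real \<Rightarrow> complex) \<Rightarrow> real \<Rightarrow> complex" where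
  "nth_derivative j f = ((\<lambda>g x. vector_derivative g (at x)) ^^ j) f"

definition sign_set :: "nat \<Rightarrow> int \<Rightarrow> (nat \<Rightarrow> int) \<Rightarrow> nat set" where
  "sign_set n s sg = {l \<in> {1..n}. sg l = s}"

text \<open>
  The sign \<open>s\<close> chooses between the upper (\<open>s = 1\<close>) and the lower (\<open>s = -1\<close>) signs in
  \<open>\<mp> \<Sum>l\<in>L\<^sub>\<plusminus>. \<lambda>\<^sub>l\<close> and \<open>sin (n\<^sub>\<plusminus> \<pi> / n)\<close>.
\<close>

definition Lambda_sum :: "int \<Rightarrow> nat \<Rightarrow> (nat \<Rightarrow> int) \<Rightarrow> (nat \<Rightarrow> complex) \<Rightarrow> complex" where
  "Lambda_sum s n sg lam = - of_int s * (\<Sum>l\<in>sign_set n s sg. lam l)"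

definition I_sin :: "int \<Rightarrow> nat \<Rightarrow> (nat \<Rightarrow> int) \<Rightarrow> real" where
  "I_sin s n sg = sin (real (card (sign_set n s sg)) / real n * pi)"

definition max_norm :: "nat \<Rightarrow> (nat \<Rightarrow> complex) \<Rightarrow> real" where
  "max_norm n lam = Max ((\<lambda>l. norm (lam l)) ` {1..n})"

definition max_Im :: "nat \<Rightarrow> (nat \<Rightarrow> complex) \<Rightarrow> real" where
  "max_Im n lam = Max ((\<lambda>l. \<bar>Im (lam l)\<bar>) ` {1..n})"

end

theory Submission
  imports Defs "HOL-Complex_Analysis.Cauchy_Integral_Formula"
begin

text \<open>
  With \<open>p\<close> plus signs and \<open>\<theta> = \<pi>/2 - \<pi>p/n\<close>, the phase factors combine to
  \<open>J(x) = exp (\<pi>\<i>\<Lambda>) M(x exp (\<i>\<theta>))\<close>, where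
  \<open>M(z) = 1/(2\<pi>\<i>) \<integral> \<Prod>\<^sub>l \<Gamma>(s - \<lambda>\<^sub>l) z\<^bsup>-ns\<^esup> ds\<close> is holomorphic for \<open>Re z > 0\<close>; here \<open>\<bar>\<theta>\<bar> < \<pi>/2\<close>
  because both signs occur, and \<open>cos \<theta> = I\<close>.  The integrand decays exponentially along vertical lines,
  so the contour may be moved to the line \<open>Re s = Re z\<close>, which contains the saddle point \<open>s = z\<close>.
  On it the integrand is bounded by its value at \<open>s = z\<close>, of size \<open>\<bar>z\<bar>\<^bsup>-n/2\<^esup> exp (-n Re z)\<close>, times a
  decaying function of \<open>(Im s - Im z) / sqrt (Re z)\<close>, which gives
  \<open>M(z) = O((Re z)\<^bsup>-(n-1)/2\<^esup> exp (-n Re z))\<close>.  The shifts \<open>\<lambda>\<^sub>l\<close> only contribute a bounded factor: their sum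
  is zero, and the second-order terms are \<open>O(C\<^sup>2 / Re z)\<close>.  Cauchy's inequality on a disc of radius \<open>1/2\<close>
  handles the derivatives.
\<close>

section \<open>Bounds for the Gamma function\<close>

text \<open>All constants must be independent of the shifts. The Gamma product is therefore
  estimated at a finite stage of Euler's product, where the shifts enter only through the quotients
  \<open>lam l\<close> / (s + k), and the limit is taken last. The estimate leaves an angle in
  (-pi/2, pi/2) free and is then exponential in Im s. Choosing this angle for each point of the line
  replaces a Gaussian integral at the saddle point.

  The contour may cross itself; what is known about a pole is that it can be joined to the far left
  without meeting the curve. Hence Cauchy's theorem is applied in its winding number form to a
  closed-up piece of the curve, and curves are compared through lines far to the right.

  The constant c has to serve every j at once, so the disc in Cauchy's inequality does not vary with
  j: it lowers Re z by at most 1/2, at the cost of a factor exp (n / 2), and it keeps Arg z away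
  from \<plusminus>pi/2.\<close>

definition ln_tele :: "real \<Rightarrow> real \<Rightarrow> real" where
  "ln_tele t y = y * ln (1 + t\<^sup>2 / y\<^sup>2) - 2 * t * arctan (t / y)"

text \<open>Integration by parts of ln (1 + t^2 / y^2) in y yields \<open>ln_tele\<close>, with the
  constant for which it vanishes at infinity. The logarithm comes from Euler's product:
  |Gamma(\<sigma>) / Gamma(\<sigma> + i t)|^2 is the product of the factors 1 + t^2 / (\<sigma> +
  k)^2.\<close>

lemma ln_tele_deriv:
  assumes "y > 0"
  shows "(ln_tele t has_real_derivative ln (1 + t\<^sup>2 / y\<^sup>2)) (at y)"
proof -
  have p: "1 + t\<^sup>2 / y\<^sup>2 > 0" by (meson add_pos_nonneg divide_nonneg_nonneg zero_le_power2 zero_less_one)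
  have p2: "y\<^sup>2 + t\<^sup>2 \<noteq> 0" using assms by (simp add: add_pos_nonneg)
  have d0: "((\<lambda>y. t\<^sup>2 / y\<^sup>2) has_real_derivative - 2 * t\<^sup>2 / y ^ 3) (at y)"
    using assms by (auto intro!: derivative_eq_intros simp: divide_simps power2_eq_square power3_eq_cube)
  have d1: "((\<lambda>y. ln (1 + t\<^sup>2 / y\<^sup>2)) has_real_derivative (- 2 * t\<^sup>2 / y ^ 3) / (1 + t\<^sup>2 / y\<^sup>2)) (at y)"
    using DERIV_chain2[where f=ln and g="\<lambda>y. 1 + t\<^sup>2 / y\<^sup>2", OF DERIV_ln_divide[OF p] DERIV_add[OF DERIV_const d0]]
    by (simp add: mult.commute)
  have dt: "((\<lambda>y. t / y) has_real_derivative - t / y\<^sup>2) (at y)"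
    using assms by (auto intro!: derivative_eq_intros simp: power2_eq_square)
  have d2: "((\<lambda>y. arctan (t / y)) has_real_derivative (- t / y\<^sup>2) / (1 + (t / y)\<^sup>2)) (at y)"
    using DERIV_chain2[where f=arctan and g="\<lambda>y. t / y", OF DERIV_arctan dt]
    by (simp add: divide_inverse mult_ac)
  have eq: "1 + t\<^sup>2 / y\<^sup>2 = (y\<^sup>2 + t\<^sup>2) / y\<^sup>2" "1 + (t/y)\<^sup>2 = (y\<^sup>2 + t\<^sup>2) / y\<^sup>2"
    using assms by (simp_all add: field_simps)
  have 1: "y * ((- 2 * t\<^sup>2 / y ^ 3) / (D / y\<^sup>2)) = - 2 * t\<^sup>2 / D" if "D \<noteq> 0" for D
    using assms that by (simp add: power2_eq_square power3_eq_cube divide_simps) 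
  have 2: "2 * t * ((- t / y\<^sup>2) / (D / y\<^sup>2)) = - 2 * t\<^sup>2 / D" if "D \<noteq> 0" for D
    using assms that by (simp add: power2_eq_square divide_simps)
  have "y * ((- 2 * t\<^sup>2 / y ^ 3) / (1 + t\<^sup>2 / y\<^sup>2)) = 2 * t * ((- t / y\<^sup>2) / (1 + (t / y)\<^sup>2))"
    unfolding eq using 1[OF p2] 2[OF p2] by (rule trans[OF _ sym])
  then show ?thesis
    using DERIV_diff[OF DERIV_mult[OF DERIV_ident d1] DERIV_cmult[OF d2, of "2 * t"]]
    by (simp add: ln_tele_def[abs_def] mult.commute)
qed

text \<open>The derivative does not increase in y, so its integral over [y, y + 1] is at most its
  value at the left end; the mean value theorem stands in for the integral.\<close>

lemma ln_tele_step:
  assumes "y > 0"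
  shows "ln_tele t (y + 1) - ln_tele t y \<le> ln (1 + t\<^sup>2 / y\<^sup>2)"
proof -
  obtain z where z: "y < z" "z < y + 1" "ln_tele t (y + 1) - ln_tele t y = (y + 1 - y) * ln (1 + t\<^sup>2 / z\<^sup>2)"
    using MVT2[of y "y+1" "ln_tele t" "\<lambda>z. ln (1 + t\<^sup>2 / z\<^sup>2)"] ln_tele_deriv assms by force
  have "ln (1 + t\<^sup>2 / z\<^sup>2) \<le> ln (1 + t\<^sup>2 / y\<^sup>2)"
  proof (rule ln_mono)
    show "0 < 1 + t\<^sup>2 / z\<^sup>2" by (meson add_pos_nonneg divide_nonneg_nonneg zero_le_power2 zero_less_one)
    show "1 + t\<^sup>2 / z\<^sup>2 \<le> 1 + t\<^sup>2 / y\<^sup>2"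
      using z assms by (intro add_left_mono divide_left_mono power_mono) auto
  qed
  then show ?thesis using z by simp
qed

lemma ln_tele_lower:
  assumes "y > 0"
  shows "ln_tele t y \<ge> - 2 * t\<^sup>2 / y"
proof -
  have "t * arctan (t/y) \<le> t * (t/y)"
  proof (cases "t \<ge> 0")
    case True then show ?thesis using assms arctan_le_self[of "t/y"] by (intro mult_left_mono) auto
  next
    case False
    then have "arctan (- t/y) \<le> - t/y" using assms by (intro arctan_le_self) (simp add: divide_nonpos_nonneg)
    then have "t/y \<le> arctan (t/y)" using arctan_minus[of "t/y"] by simp
    then show ?thesis using False by (intro mult_left_mono_neg) auto
  qed
  moreover have "y * ln (1 + t\<^sup>2 / y\<^sup>2) \<ge> 0" using assms by simp
  ultimately show ?thesis unfolding ln_tele_def by (simp add: power2_eq_square)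
qed

text \<open>The steps telescope. The first term on the right tends to 0 with m, so in the limit the
  sum is compared with the integral from \<sigma> to infinity, which is
  \<open>- ln_tele t \<sigma>\<close>.\<close>

lemma sum_ln_lower:
  assumes "\<sigma> > 0"
  shows "(\<Sum>k\<le>m. ln (1 + t\<^sup>2 / (\<sigma> + real k)\<^sup>2)) \<ge> - 2 * t\<^sup>2 / (\<sigma> + real m + 1) - ln_tele t \<sigma>"
proof -
  have "(\<Sum>k\<le>m. ln (1 + t\<^sup>2 / (\<sigma> + real k)\<^sup>2)) \<ge> ln_tele t (\<sigma> + real m + 1) - ln_tele t \<sigma>"
  proof (induction m)
    case 0 then show ?case using ln_tele_step[of \<sigma> t] assms by simp
  next
    case (Suc m) 
    then show ?case using ln_tele_step[of "\<sigma> + real m + 1" t] assms by (simp add: add_ac)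
  qed
  then show ?thesis using ln_tele_lower[of "\<sigma> + real m + 1" t] assms by linarith
qed

lemma ln_cos_deriv: "cos x > 0 \<Longrightarrow> ((\<lambda>x. ln (cos x)) has_real_derivative - tan x) (at x)"
  by (auto intro!: derivative_eq_intros simp: tan_def)

text \<open>The angle \<open>\<phi> = arctan u\<close> minimises \<open>\<phi> \<mapsto> -u\<phi> - ln (cos \<phi>)\<close>.\<close>

lemma half_ln_le:
  assumes "\<bar>\<phi>\<bar> < pi/2"
  shows "ln (1 + u\<^sup>2) / 2 - u * arctan u \<le> - u * \<phi> - ln (cos \<phi>)"
proof -
  define \<psi> where "\<psi> = arctan u"
  have u: "u = tan \<psi>" by (simp add: \<psi>_def tan_arctan)
  have b: "-(pi/2) < \<psi>" "\<psi> < pi/2" using arctan_bounded[of u] by (auto simp: \<psi>_def)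
  have cp: "cos x > 0" if "-(pi/2) < x" "x < pi/2" for x using that cos_gt_zero_pi by blast
  have "1 + u\<^sup>2 = inverse ((cos \<psi>)\<^sup>2)"
    using tan_sec[of \<psi>] cp[OF b] unfolding u by (simp add: power_inverse)
  then have l: "ln (1 + u\<^sup>2) / 2 = - ln (cos \<psi>)"
    using cp[OF b] by (simp add: ln_inverse ln_realpow)
  have der: "((\<lambda>x. u * x + ln (cos x)) has_real_derivative u - tan x) (at x)"
    if "-(pi/2) < x" "x < pi/2" for x
    using DERIV_add[OF DERIV_cmult[OF DERIV_ident, of u] ln_cos_deriv[OF cp[OF that]]] by simp
  have "u * \<psi> + ln (cos \<psi>) \<ge> u * \<phi> + ln (cos \<phi>)"
  proof -
    consider "\<psi> = \<phi>" | "\<psi> < \<phi>" | "\<phi> < \<psi>" by linarith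
    then show ?thesis
    proof cases
      case 2
      obtain z where z: "\<psi> < z" "z < \<phi>" "(u * \<phi> + ln (cos \<phi>)) - (u * \<psi> + ln (cos \<psi>)) = (\<phi> - \<psi>) * (u - tan z)"
        using MVT2[OF 2, of "\<lambda>x. u * x + ln (cos x)" "\<lambda>z. u - tan z"] der[of _] assms b by force
      moreover have "u \<le> tan z" unfolding u using z assms b by (intro tan_mono_le) auto
      ultimately show ?thesis using 2 by (smt (verit) mult_nonneg_nonpos)
    next
      case 3
      obtain z where z: "\<phi> < z" "z < \<psi>" "(u * \<psi> + ln (cos \<psi>)) - (u * \<phi> + ln (cos \<phi>)) = (\<psi> - \<phi>) * (u - tan z)"
        using MVT2[OF 3, of "\<lambda>x. u * x + ln (cos x)" "\<lambda>z. u - tan z"] der[of _] assms b by force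
      moreover have "u \<ge> tan z" unfolding u using z assms b by (intro tan_mono_le) auto
      ultimately show ?thesis using 3 by (smt (verit) mult_nonneg_nonneg)
    qed auto
  qed
  then show ?thesis unfolding l by (simp add: \<psi>_def)
qed

text \<open>The two sides agree at \<phi> = arctan (t / \<sigma>). Giving up this optimal angle
  makes the right-hand side linear in t for fixed \<phi>, as exponential decay along a vertical line
  requires.\<close>

lemma ln_tele_le:
  assumes "\<bar>\<phi>\<bar> < pi/2" "\<sigma> > 0"
  shows "ln_tele t \<sigma> / 2 \<le> - t * \<phi> - \<sigma> * ln (cos \<phi>)"
proof -
  have "\<sigma> * (ln (1 + (t/\<sigma>)\<^sup>2) / 2 - (t/\<sigma>) * arctan (t/\<sigma>)) \<le> \<sigma> * (- (t/\<sigma>) * \<phi> - ln (cos \<phi>))"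
    using half_ln_le[OF assms(1)] assms(2) by (intro mult_left_mono) (auto simp del: times_divide_eq_left)
  then show ?thesis using assms(2) unfolding ln_tele_def by (simp add: algebra_simps power_divide diff_divide_distrib)
qed

text \<open>The terms with k > 0 telescope to at most 1 / \<sigma>, and the term k = 0 is at most 1
  / \<sigma> because \<sigma> \<ge> 1. The sum measures the total second-order effect of the
  shifts.\<close>

lemma sum_inv_sq_le:
  assumes "\<sigma> \<ge> (1::real)"
  shows "(\<Sum>k\<le>m. 1 / (\<sigma> + real k)\<^sup>2) \<le> 2 / \<sigma>"
proof -
  have "(\<Sum>k\<le>m. 1 / (\<sigma> + real k)\<^sup>2) \<le> 1/\<sigma>\<^sup>2 + 1/\<sigma> - 1/(\<sigma> + real m)"
  proof (induction m)
    case (Suc m)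
    define y where "y = \<sigma> + real m"
    have y: "y \<ge> 1" using assms by (simp add: y_def)
    have "1/(y+1)\<^sup>2 \<le> 1/(y*(y+1))" using y
      by (intro divide_left_mono) (auto simp: power2_eq_square intro!: mult_mono)
    also have "\<dots> = 1/y - 1/(y+1)" using y by (simp add: field_simps)
    finally have "1/(y+1)\<^sup>2 \<le> 1/y - 1/(y+1)" .
    then show ?case using Suc by (simp add: y_def add_ac)
  qed auto
  also have "\<dots> \<le> 1/\<sigma>\<^sup>2 + 1/\<sigma>" using assms by simp
  also have "1/\<sigma>\<^sup>2 \<le> 1/\<sigma>" using assms by (intro divide_left_mono) (auto simp: power2_eq_square)
  finally show ?thesis using assms by simp
qed

text \<open>The linear term is kept exactly, since it will cancel in a sum over the shifts. With |1
  - w|^2 = 1 + y one has |y| \<le> 3 |w| and |y| \<le> 1/2, and half of the error 2 y^2 in the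
  logarithm produces the constant 9.\<close>

lemma inverse_norm_one_minus_le:
  fixes w :: complex
  assumes "norm w \<le> 1/5"
  shows "1 / norm (1 - w) \<le> exp (Re w + 9 * (norm w)\<^sup>2)"
proof -
  define a b where "a = Re w" and "b = (norm w)\<^sup>2"
  define y where "y = - 2 * a + b"
  have n1: "(norm (1 - w))\<^sup>2 = 1 + y"
    unfolding y_def a_def b_def cmod_power2 by (simp add: power2_eq_square algebra_simps)
  have ab: "\<bar>a\<bar> \<le> norm w" by (simp add: a_def abs_Re_le_cmod)
  have b: "0 \<le> b" "b \<le> norm w" 
    using assms unfolding b_def by (auto simp: power2_eq_square intro!: mult_left_le)
  have y3: "\<bar>y\<bar> \<le> 3 * norm w" using ab b unfolding y_def by linarith
  have b2: "b \<le> 1/25" using power_mono[OF assms norm_ge_zero, of 2] by (simp add: b_def power2_eq_square)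
  have y12: "\<bar>y\<bar> \<le> 1/2" using ab assms b b2 unfolding y_def by linarith
  have "\<bar>y\<bar>\<^sup>2 \<le> (3 * norm w)\<^sup>2" using y3 by (intro power_mono) auto
  then have ysq: "y\<^sup>2 \<le> 9 * b" by (simp add: b_def power_mult_distrib)
  have "\<bar>ln (1 + y) - y\<bar> \<le> 2 * y\<^sup>2" by (rule abs_ln_one_plus_x_minus_x_bound[OF y12])
  then have "- ln (1 + y) / 2 \<le> a + 9 * b" using ysq b unfolding y_def by linarith
  moreover have "norm (1 - w) > 0" using assms by auto
  moreover have "ln (norm (1 - w)) = ln (1 + y) / 2"
    using calculation(2) by (simp flip: n1 add: ln_realpow)
  moreover have "1 / norm (1 - w) = exp (- ln (norm (1 - w)))"
    using calculation(2) by (simp add: exp_minus inverse_eq_divide)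
  ultimately show ?thesis by (simp add: a_def b_def)
qed

text \<open>The quotient of Gamma by the Stirling term does not increase under x \<mapsto> x + 1, so
  its maximum on [1, 2] bounds it for all x \<ge> 1.\<close>

lemma Gamma_le_Stirling:
  "\<exists>K>0. \<forall>x\<ge>1::real. Gamma x \<le> K * x powr (x - 1/2) * exp (- x)"
proof -
  define f where "f x = Gamma x / (x powr (x - 1/2) * exp (- x))" for x :: real
  have pos: "f x > 0" if "x > 0" for x using that by (simp add: f_def Gamma_real_pos)
  have step: "f (x + 1) \<le> f x" if "x \<ge> 1" for x
  proof -
    define d where "d = ln (x+1) - ln x"
    \<comment> \<open>Monotonicity of the quotient amounts to (x + 1/2) ln ((x + 1) / x) \<ge> 1.
      This is the lower bound of the logarithm by twice the difference over the sum of its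
      arguments.\<close>
    have "2 * (x + 1 - x) / (x + (x + 1)) \<le> d"
      using ln_inverse_approx_ge[of x "x+1"] that by (simp add: d_def)
    then have "2 \<le> d * (x + (x + 1))" using that by (simp add: divide_le_eq)
    then have "1 \<le> (x + 1/2) * d" by (simp add: algebra_simps)
    then have "ln x + ((x - 1/2) * ln x + - x) \<le> (x + 1/2) * ln (x+1) + - (x+1)"
      unfolding d_def by (simp only: algebra_simps)
    then have "exp (ln x + ((x - 1/2) * ln x + - x)) \<le> exp ((x + 1/2) * ln (x+1) + - (x+1))"
      by (rule iffD2[OF exp_le_cancel_iff])
    then have "x * (x powr (x - 1/2) * exp (-x)) \<le> (x+1) powr (x+1/2) * exp (-(x+1))"
      unfolding exp_add using that by (simp add: powr_def)
    note le = this
    have G: "Gamma (x+1) = x * Gamma x" "Gamma x > 0"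
      using that by (auto intro!: Gamma_plus1 elim!: nonpos_Ints_cases)
    define A where "A = x powr (x - 1/2) * exp (-x)"
    define B where "B = (x+1) powr (x+1/2) * exp (-(x+1))"
    have AB: "A > 0" "x * A \<le> B" and "B > 0" using le that by (auto simp: A_def B_def)
    have "Gamma x * (x * A) \<le> Gamma x * B" using AB G by (intro mult_left_mono) auto
    then have "x * Gamma x / B \<le> Gamma x / A" using \<open>B > 0\<close> AB(1) by (simp add: divide_simps mult_ac)
    then show ?thesis unfolding f_def A_def B_def using G(1) by (simp add: add.commute)
  qed
  have cont: "continuous_on {1..2} f" unfolding f_def
    by (intro continuous_intros continuous_on_Gamma) (auto elim!: nonpos_Ints_cases)
  obtain z where z: "\<And>x. x \<in> {1..2} \<Longrightarrow> f x \<le> f z"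
    using continuous_attains_sup[OF compact_Icc _ cont] by (metis atLeastAtMost_iff empty_iff one_le_numeral order_refl)
  define K where "K = f z"
  have K: "f x \<le> K" if "x \<in> {1..2}" for x using z[OF that] by (simp add: K_def)
  have shift: "f (y + real m) \<le> f y" if "y \<ge> 1" for y m
  proof (induction m)
    case (Suc m)
    have "f (y + real m + 1) \<le> f (y + real m)" using that by (intro step) auto
    with Suc show ?case by (simp add: add_ac)
  qed auto
  have "f x \<le> K" if "x \<ge> 1" for x
  proof -
    define m where "m = nat (\<lfloor>x\<rfloor> - 1)"
    have "1 \<le> \<lfloor>x\<rfloor>" using that by simp
    then have m: "real m = of_int \<lfloor>x\<rfloor> - 1" by (simp add: m_def)
    have "1 \<le> x - real m" "x - real m \<le> 2" unfolding m by linarith+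
    then show ?thesis using shift[of "x - real m" m] K[of "x - real m"] by auto
  qed
  then have "Gamma x \<le> K * (x powr (x - 1/2) * exp (- x))" if "x \<ge> 1" for x
    using that[THEN \<open>\<And>x. x \<ge> 1 \<Longrightarrow> f x \<le> K\<close>] that by (simp add: f_def pos_divide_le_eq)
  moreover have "K > 0" using K[of 1] pos[of 1] by force
  ultimately show ?thesis by (intro exI[of _ K]) (simp add: mult.assoc)
qed

section \<open>Products of shifted Gamma functions\<close>

lemma Re_sum_div_eq_0:
  fixes lam :: "'a \<Rightarrow> complex"
  assumes "(\<Sum>l\<in>A. lam l) = 0" shows "(\<Sum>l\<in>A. Re (lam l / w)) = 0"
  using assms by (simp flip: Re_sum sum_divide_distrib)

lemma Gamma_series_norm:
  fixes z :: complex
  shows "norm (Gamma_series z m) = fact m * exp (Re z * ln (real m)) * (\<Prod>k\<le>m. 1 / norm (z + of_nat k))"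
proof -
  have "norm (pochhammer z (m + 1)) = (\<Prod>k\<le>m. norm (z + of_nat k))"
    by (simp add: pochhammer_Suc_prod prod_norm atLeast0AtMost)
  then show ?thesis by (simp add: Gamma_series_def norm_divide norm_mult prod_dividef)
qed

text \<open>Since the shifts sum to zero, their first-order contributions to Euler's product cancel.\<close>

lemma norm_prod_Gamma_le:
  fixes lam :: "'a \<Rightarrow> complex" and C \<sigma> t \<phi> :: real
  assumes A: "finite A" and sum0: "(\<Sum>l\<in>A. lam l) = 0" and C: "\<And>l. l \<in> A \<Longrightarrow> norm (lam l) \<le> C"
    and \<sigma>: "\<sigma> \<ge> 1" "5 * C \<le> \<sigma>" and \<phi>: "\<bar>\<phi>\<bar> < pi / 2"
  shows "norm (\<Prod>l\<in>A. Gamma (Complex \<sigma> t - lam l))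
     \<le> exp (18 * card A * C\<^sup>2 / \<sigma>) * (Gamma \<sigma> * exp (- \<phi> * t - \<sigma> * ln (cos \<phi>))) ^ card A"
proof -
  define N where "N = card A"
  define s where "s = Complex \<sigma> t"
  define D where "D k = ln (1 + t\<^sup>2 / (\<sigma> + real k)\<^sup>2)" for k
  have Cs: "C / (\<sigma> + real k) \<le> 1/5" for k using \<sigma> by (simp add: field_simps)
  \<comment> \<open>The k-th factor of Euler's product is taken over all l at once. The denominator
    w = s + k is the same for all l, so the linear terms Re (\<open>lam l\<close> / w) add up to
    0.\<close>
  have factor: "(\<Prod>l\<in>A. 1 / norm (s - lam l + of_nat k))
      \<le> exp (9 * N * C\<^sup>2 * (1 / (\<sigma> + real k)\<^sup>2)) * ((1 / (\<sigma> + real k)) * exp (- D k / 2)) ^ N" for k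
  proof -
    define w where "w = s + of_nat k"
    define y where "y = \<sigma> + real k"
    have y: "y \<ge> 1" using \<sigma> by (simp add: y_def)
    have wy: "Re w = y" "Im w = t" by (simp_all add: w_def y_def s_def)
    have nw: "norm w \<ge> y" using wy(1) complex_Re_le_cmod by metis
    then have w0: "norm w > 0" "w \<noteq> 0" using y by auto
    have "(norm w)\<^sup>2 = y\<^sup>2 * (1 + t\<^sup>2 / y\<^sup>2)" using y by (simp add: cmod_power2 wy field_simps)
    then have "2 * ln (norm w) = ln (y\<^sup>2 * (1 + t\<^sup>2 / y\<^sup>2))" 
      using w0 by (metis ln_realpow of_nat_numeral)
    also have "\<dots> = 2 * ln y + D k"
      using y unfolding D_def by (subst ln_mult_pos) (auto simp: y_def ln_realpow add_pos_nonneg)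
    finally have "ln (norm w) = ln y + D k / 2" by simp
    then have "exp (ln (norm w)) = exp (ln y) * exp (D k / 2)" by (simp only: exp_add)
    then have nweq: "1 / norm w = 1 / y * exp (- D k / 2)"
      using w0 y by (simp add: exp_minus inverse_eq_divide)
    have "1 / norm (s - lam l + of_nat k) \<le> exp (Re (lam l / w) + 9 * (C / y)\<^sup>2) * (1 / norm w)" if l: "l \<in> A" for l
    proof -
      have 1: "norm (lam l / w) \<le> C / y"
        using C[OF l] nw y by (simp add: norm_divide) (intro frac_le, auto intro: order_trans[OF norm_ge_zero])
      also have "\<dots> \<le> 1/5" using Cs[of k] by (simp add: y_def)
      finally have 2: "norm (lam l / w) \<le> 1/5" .
      have "s - lam l + of_nat k = w * (1 - lam l / w)" using w0 by (simp add: w_def field_simps)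
      then have "1 / norm (s - lam l + of_nat k) = 1 / norm (1 - lam l / w) * (1 / norm w)" by (simp add: norm_mult)
      also have "\<dots> \<le> exp (Re (lam l / w) + 9 * (norm (lam l / w))\<^sup>2) * (1 / norm w)"
        by (intro mult_right_mono inverse_norm_one_minus_le 2) auto
      also have "\<dots> \<le> exp (Re (lam l / w) + 9 * (C / y)\<^sup>2) * (1 / norm w)"
        using power_mono[OF 1 norm_ge_zero, of 2] by (intro mult_right_mono) auto
      finally show ?thesis .
    qed
    then have "(\<Prod>l\<in>A. 1 / norm (s - lam l + of_nat k)) \<le> (\<Prod>l\<in>A. exp (Re (lam l / w) + 9 * (C / y)\<^sup>2) * (1 / norm w))"
      by (intro prod_mono) auto
    also have "\<dots> = exp (\<Sum>l\<in>A. Re (lam l / w) + 9 * (C / y)\<^sup>2) * (1 / norm w) ^ N"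
      using A by (simp only: prod.distrib exp_sum prod_constant N_def)
    also have "(\<Sum>l\<in>A. Re (lam l / w) + 9 * (C / y)\<^sup>2) = 9 * N * C\<^sup>2 * (1 / y\<^sup>2)"
      by (simp add: sum.distrib Re_sum_div_eq_0[OF sum0] N_def power_divide)
    finally show ?thesis by (simp only: nweq y_def)
  qed
  have series: "norm (\<Prod>l\<in>A. Gamma_series (s - lam l) m)
      \<le> exp (18 * N * C\<^sup>2 / \<sigma>) * (Gamma_series \<sigma> m * exp (t\<^sup>2 / (\<sigma> + real m + 1) + (- \<phi> * t - \<sigma> * ln (cos \<phi>)))) ^ N" for m
  proof -
    define E where "E = fact m * exp (\<sigma> * ln (real m))"
    have Gs: "Gamma_series \<sigma> m = E * (\<Prod>k\<le>m. 1 / (\<sigma> + real k))"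
      by (simp add: Gamma_series_def E_def pochhammer_Suc_prod atLeast0AtMost prod_dividef)
    have Gpos: "Gamma_series \<sigma> m \<ge> 0" unfolding Gs E_def using \<sigma> by (intro mult_nonneg_nonneg prod_nonneg) auto
    have "(\<Prod>l\<in>A. exp (Re (s - lam l) * ln (real m))) = exp (\<Sum>l\<in>A. Re (s - lam l) * ln (real m))"
      using A by (simp add: exp_sum)
    also have "(\<Sum>l\<in>A. Re (s - lam l) * ln (real m)) = (\<Sum>l\<in>A. Re (s - lam l)) * ln (real m)" by (simp add: sum_distrib_right)
    also have "(\<Sum>l\<in>A. Re (s - lam l)) = N * \<sigma>"
      using Re_sum_div_eq_0[OF sum0, of 1] by (simp add: s_def sum_subtractf N_def)
    finally have pe: "(\<Prod>l\<in>A. fact m * exp (Re (s - lam l) * ln (real m))) = E ^ N"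
      by (simp add: prod.distrib E_def power_mult_distrib N_def mult.assoc flip: exp_of_nat_mult)
    have "norm (\<Prod>l\<in>A. Gamma_series (s - lam l) m) 
        = (\<Prod>l\<in>A. fact m * exp (Re (s - lam l) * ln (real m))) * (\<Prod>l\<in>A. \<Prod>k\<le>m. 1 / norm (s - lam l + of_nat k))"
      by (simp only: prod_norm[symmetric] Gamma_series_norm prod.distrib)
    \<comment> \<open>After the interchange the product over l is the inner one, as the cancellation
      in \<open>factor\<close> demands.\<close>
    also have "\<dots> = E ^ N * (\<Prod>k\<le>m. \<Prod>l\<in>A. 1 / norm (s - lam l + of_nat k))"
      by (subst prod.swap) (simp only: pe)
    also have "\<dots> \<le> E ^ N * (\<Prod>k\<le>m. exp (9 * N * C\<^sup>2 * (1 / (\<sigma> + real k)\<^sup>2)) * ((1 / (\<sigma> + real k)) * exp (- D k / 2)) ^ N)"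
      by (intro mult_left_mono prod_mono conjI factor prod_nonneg) (auto simp: E_def)
    also have "\<dots> = exp (9 * N * C\<^sup>2 * (\<Sum>k\<le>m. 1 / (\<sigma> + real k)\<^sup>2)) * (Gamma_series \<sigma> m * exp (- (\<Sum>k\<le>m. D k) / 2)) ^ N"
    proof -
      have "exp (- (\<Sum>k\<le>m. D k) / 2) = (\<Prod>k\<le>m. exp (- D k / 2))"
        by (simp flip: exp_sum add: sum_negf sum_divide_distrib)
      moreover have "exp (9 * N * C\<^sup>2 * (\<Sum>k\<le>m. 1 / (\<sigma> + real k)\<^sup>2)) = (\<Prod>k\<le>m. exp (9 * N * C\<^sup>2 * (1 / (\<sigma> + real k)\<^sup>2)))"
        by (simp flip: exp_sum add: sum_distrib_left)
      ultimately show ?thesis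
        by (simp only: prod.distrib Gs power_mult_distrib prod_power_distrib mult_ac)
    qed
    also have "\<dots> \<le> exp (18 * N * C\<^sup>2 / \<sigma>) * (Gamma_series \<sigma> m * exp (t\<^sup>2 / (\<sigma> + real m + 1) + (- \<phi> * t - \<sigma> * ln (cos \<phi>)))) ^ N"
    proof (rule mult_mono)
      have "9 * N * C\<^sup>2 * (\<Sum>k\<le>m. 1 / (\<sigma> + real k)\<^sup>2) \<le> 9 * N * C\<^sup>2 * (2 / \<sigma>)"
        by (intro mult_left_mono sum_inv_sq_le \<sigma>) auto
      then show "exp (9 * N * C\<^sup>2 * (\<Sum>k\<le>m. 1 / (\<sigma> + real k)\<^sup>2)) \<le> exp (18 * N * C\<^sup>2 / \<sigma>)" by simp
      have "- (\<Sum>k\<le>m. D k) / 2 \<le> t\<^sup>2 / (\<sigma> + real m + 1) + (- \<phi> * t - \<sigma> * ln (cos \<phi>))"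
        using sum_ln_lower[of \<sigma> t m] ln_tele_le[OF \<phi>, of \<sigma> t] \<sigma> unfolding D_def by (simp add: mult.commute)
      then show "(Gamma_series \<sigma> m * exp (- (\<Sum>k\<le>m. D k) / 2)) ^ N \<le> (Gamma_series \<sigma> m * exp (t\<^sup>2 / (\<sigma> + real m + 1) + (- \<phi> * t - \<sigma> * ln (cos \<phi>)))) ^ N"
        using Gpos by (intro power_mono mult_left_mono) auto
    qed (use Gpos in auto)
    finally show ?thesis .
  qed
  have z: "(\<lambda>m. t\<^sup>2 / (\<sigma> + real m + 1)) \<longlonglongrightarrow> 0"
    by (rule real_tendsto_divide_at_top[OF tendsto_const]) 
       (rule filterlim_at_top_mono[OF filterlim_real_sequentially], use \<sigma> in auto)
  have "norm (\<Prod>l\<in>A. Gamma (s - lam l)) \<le> exp (18 * N * C\<^sup>2 / \<sigma>) * (Gamma \<sigma> * exp (0 + (- \<phi> * t - \<sigma> * ln (cos \<phi>)))) ^ N"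
  proof (rule tendsto_le[OF sequentially_bot])
    show "(\<lambda>m. exp (18 * N * C\<^sup>2 / \<sigma>) * (Gamma_series \<sigma> m * exp (t\<^sup>2 / (\<sigma> + real m + 1) + (- \<phi> * t - \<sigma> * ln (cos \<phi>)))) ^ N)
      \<longlonglongrightarrow> exp (18 * N * C\<^sup>2 / \<sigma>) * (Gamma \<sigma> * exp (0 + (- \<phi> * t - \<sigma> * ln (cos \<phi>)))) ^ N"
      by (intro tendsto_intros z)
    show "(\<lambda>m. norm (\<Prod>l\<in>A. Gamma_series (s - lam l) m)) \<longlonglongrightarrow> norm (\<Prod>l\<in>A. Gamma (s - lam l))"
      by (intro tendsto_intros)
  qed (use series in simp)
  then show ?thesis by (simp add: N_def s_def)
qed

text \<open>This is the bound that Euler's integral for Gamma gives on the ray of argument \<phi>: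
  there |w^s| contributes exp (- \<phi> t), and exp (- r cos \<phi>) rescales Gamma(\<sigma>) by cos
  \<phi> to the power - \<sigma>.\<close>

lemma norm_Gamma_le:
  assumes "\<sigma> \<ge> 1" "\<bar>\<phi>\<bar> < pi / 2"
  shows "norm (Gamma (Complex \<sigma> t)) \<le> Gamma \<sigma> * exp (- \<phi> * t - \<sigma> * ln (cos \<phi>))"
  using norm_prod_Gamma_le[of "{0::nat}" "\<lambda>_. 0" 0 \<sigma> \<phi> t] assms by simp

text \<open>The functional equation moves the strip to the right of 1. As |Im s| \<ge> 1, every
  factor s + k has modulus at least 1, so |Gamma(s)| \<le> |Gamma(s + m)|.\<close>

lemma Gamma_strip_decay:
  assumes "0 < \<phi>" "\<phi> < pi / 2"
  shows "\<exists>K\<ge>0::real. \<forall>s. a \<le> Re s \<and> Re s \<le> b \<and> \<bar>Im s\<bar> \<ge> 1 \<longrightarrow> norm (Gamma s) \<le> K * exp (- \<phi> * \<bar>Im s\<bar>)"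
proof -
  define m where "m = nat \<lceil>1 - a\<rceil>"
  have am: "a + real m \<ge> 1" unfolding m_def by linarith
  have cont: "continuous_on {a + real m..b + real m} (\<lambda>x. Gamma x * exp (- x * ln (cos \<phi>)))"
    using am by (intro continuous_intros continuous_on_Gamma) (auto elim!: nonpos_Ints_cases)
  then have "bounded ((\<lambda>x. Gamma x * exp (- x * ln (cos \<phi>))) ` {a + real m..b + real m})"
    using compact_continuous_image compact_imp_bounded by blast
  then obtain K where K: "K > 0" "\<And>x. x \<in> {a + real m..b + real m} \<Longrightarrow> \<bar>Gamma x * exp (- x * ln (cos \<phi>))\<bar> \<le> K"
    unfolding bounded_pos by auto
  have "norm (Gamma s) \<le> K * exp (- \<phi> * \<bar>Im s\<bar>)" if s: "a \<le> Re s" "Re s \<le> b" "\<bar>Im s\<bar> \<ge> 1" for s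
  proof -
    have ns: "s \<notin> \<int>\<^sub>\<le>\<^sub>0" using s by (auto elim!: nonpos_Ints_cases)
    have "1 \<le> norm (s + of_nat k)" for k 
      using abs_Im_le_cmod[of "s + of_nat k"] s by simp
    then have "1 \<le> norm (pochhammer s m)"
      unfolding pochhammer_prod prod_norm[symmetric] by (intro prod_ge_1) auto
    moreover have "pochhammer s m * Gamma s = Gamma (s + of_nat m)"
      using pochhammer_Gamma[OF ns, of m] ns by (simp add: Gamma_eq_zero_iff)
    then have "norm (pochhammer s m) * norm (Gamma s) = norm (Gamma (s + of_nat m))"
      by (metis norm_mult)
    ultimately have "norm (Gamma s) \<le> norm (Gamma (s + of_nat m))"
      by (metis mult_le_cancel_right1 norm_ge_zero norm_not_less_zero)
    also have "s + of_nat m = Complex (Re s + real m) (Im s)" by (simp add: complex_eq_iff)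
    \<comment> \<open>The angle takes the sign of Im s, which gives decay in both directions; the
      cosine is even.\<close>
    also have "norm (Gamma \<dots>) \<le> Gamma (Re s + real m) * exp (- (sgn (Im s) * \<phi>) * Im s - (Re s + real m) * ln (cos (sgn (Im s) * \<phi>)))"
      using s am assms by (intro norm_Gamma_le) (auto simp: sgn_if)
    also have "\<dots> = (Gamma (Re s + real m) * exp (- (Re s + real m) * ln (cos \<phi>))) * exp (- \<phi> * \<bar>Im s\<bar>)"
      using s by (auto simp: sgn_if abs_if mult_exp_exp algebra_simps)
    also have "\<dots> \<le> K * exp (- \<phi> * \<bar>Im s\<bar>)"
      using K(2)[of "Re s + real m"] s by (intro mult_right_mono) auto
    finally show ?thesis .
  qed
  then show ?thesis using K(1) by (intro exI[of _ K]) auto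
qed

text \<open>K and T may depend on \<open>lam\<close> here: this bound serves convergence and the
  shifting of contours, while the estimate uniform in the shifts is
  \<open>norm_prod_Gamma_le\<close>.\<close>

lemma prod_Gamma_strip_decay:
  fixes lam :: "'a \<Rightarrow> complex" and \<phi> :: real
  assumes "finite A" "0 < \<phi>" "\<phi> < pi / 2"
  shows "\<exists>K\<ge>0::real. \<exists>T::real. \<forall>s. a \<le> Re s \<and> Re s \<le> b \<and> \<bar>Im s\<bar> \<ge> T \<longrightarrow> 
           norm (\<Prod>l\<in>A. Gamma (s - lam l)) \<le> K * exp (- (card A * \<phi>) * \<bar>Im s\<bar>)"
  using assms(1)
proof induction
  case empty
  show ?case by (intro exI[of _ 1]) auto
next
  case (insert l A)
  obtain K T where K: "K \<ge> 0" "\<And>s. a \<le> Re s \<and> Re s \<le> b \<and> \<bar>Im s\<bar> \<ge> T \<Longrightarrow>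
           norm (\<Prod>l\<in>A. Gamma (s - lam l)) \<le> K * exp (- (card A * \<phi>) * \<bar>Im s\<bar>)"
    using insert.IH by auto
  obtain L where L: "L \<ge> 0" "\<And>s. a - Re (lam l) \<le> Re s \<and> Re s \<le> b - Re (lam l) \<and> \<bar>Im s\<bar> \<ge> 1 \<Longrightarrow> norm (Gamma s) \<le> L * exp (- \<phi> * \<bar>Im s\<bar>)"
    using Gamma_strip_decay[OF assms(2,3), of "a - Re (lam l)" "b - Re (lam l)"] by blast
  define M where "M = L * exp (\<phi> * \<bar>Im (lam l)\<bar>)"
  show ?case
  proof (rule exI[of _ "M * K"], intro exI[of _ "max T (1 + \<bar>Im (lam l)\<bar>)"] allI conjI impI)
    show "M * K \<ge> 0" using K L by (auto simp: M_def)
    fix s assume s: "a \<le> Re s \<and> Re s \<le> b \<and> \<bar>Im s\<bar> \<ge> max T (1 + \<bar>Im (lam l)\<bar>)"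
    have "norm (Gamma (s - lam l)) \<le> L * exp (- \<phi> * \<bar>Im s - Im (lam l)\<bar>)"
      using L(2)[of "s - lam l"] s by auto
    also have "- \<phi> * \<bar>Im s - Im (lam l)\<bar> \<le> - \<phi> * (\<bar>Im s\<bar> - \<bar>Im (lam l)\<bar>)"
      using assms(2) by (intro mult_left_mono_neg) auto
    then have "L * exp (- \<phi> * \<bar>Im s - Im (lam l)\<bar>) \<le> L * exp (- \<phi> * (\<bar>Im s\<bar> - \<bar>Im (lam l)\<bar>))"
      using L(1) by (intro mult_left_mono) auto
    also have "\<dots> = M * exp (- \<phi> * \<bar>Im s\<bar>)" by (simp add: M_def mult_exp_exp algebra_simps)
    finally have 1: "norm (Gamma (s - lam l)) \<le> M * exp (- \<phi> * \<bar>Im s\<bar>)" .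
    have "norm (\<Prod>l\<in>insert l A. Gamma (s - lam l)) = norm (Gamma (s - lam l)) * norm (\<Prod>l\<in>A. Gamma (s - lam l))"
      using insert by (simp add: norm_mult)
    also have "\<dots> \<le> (M * exp (- \<phi> * \<bar>Im s\<bar>)) * (K * exp (- (card A * \<phi>) * \<bar>Im s\<bar>))"
      using L(1) K(2)[of s] s by (intro mult_mono 1) (auto simp: M_def)
    also have "\<dots> = M * K * exp (- (card (insert l A) * \<phi>) * \<bar>Im s\<bar>)"
      using insert by (simp add: mult_exp_exp algebra_simps)
    finally show "norm (\<Prod>l\<in>insert l A. Gamma (s - lam l)) \<le> M * K * exp (- (card (insert l A) * \<phi>) * \<bar>Im s\<bar>)" .
  qed
qed

section \<open>Integrals along vertical contours\<close>

lemma has_integral_exp_abs_shift: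
  fixes a t0 :: real
  assumes "a > 0"
  shows "((\<lambda>t. exp (- a * \<bar>t - t0\<bar>)) has_integral 2 / a) UNIV"
proof -
  have up: "((\<lambda>t. exp (- a * \<bar>t - t0\<bar>)) has_integral 1 / a) {t0..}" for t0
  proof -
    have "((\<lambda>t. exp (a * t0) * exp (- a * t)) has_integral exp (a * t0) * (exp (- a * t0) / a)) {t0..}"
      by (intro has_integral_mult_right has_integral_exp_minus_to_infinity assms)
    moreover have "exp (a * t0) * (exp (- a * t0) / a) = 1 / a" by (simp add: exp_minus field_simps)
    ultimately show ?thesis
      by (auto elim!: has_integral_eq[rotated] simp: mult_exp_exp algebra_simps)
  qed
  have "(\<lambda>t. exp (- a * \<bar>t + t0\<bar>)) absolutely_integrable_on {- t0..} \<and> integral {- t0..} (\<lambda>t. exp (- a * \<bar>t + t0\<bar>)) = 1 / a"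
    using up[of "- t0"] by (auto simp: has_integral_iff intro!: nonnegative_absolutely_integrable_1)
  moreover have "uminus ` {- t0..} \<subseteq> {..t0}" "uminus ` {..t0} \<subseteq> {- t0..}" by auto
  ultimately have "(\<lambda>t. exp (- a * \<bar>- t + t0\<bar>)) absolutely_integrable_on {..t0} \<and> integral {..t0} (\<lambda>t. exp (- a * \<bar>- t + t0\<bar>)) = 1 / a"
    by (subst has_absolute_integral_reflect_real) auto
  then have down: "((\<lambda>t. exp (- a * \<bar>t - t0\<bar>)) has_integral 1 / a) {..t0}"
    by (simp add: has_integral_iff set_lebesgue_integral_eq_integral(1) abs_minus_commute add.commute)
  have "((\<lambda>t. exp (- a * \<bar>t - t0\<bar>)) has_integral (1 / a + 1 / a)) ({..t0} \<union> {t0..})"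
  proof (intro has_integral_Un down up)
    have "{..t0} \<inter> {t0..} = {t0}" by auto
    then show "negligible ({..t0} \<inter> {t0..})" by simp
  qed
  moreover have "{..t0} \<union> {t0..} = UNIV" by auto
  ultimately show ?thesis by simp
qed

text \<open>The integrand is dominated only for large |t|, so the two tails are treated by
  comparison and the compact middle part is joined to them.\<close>

lemma integrable_exp_tail:
  fixes g :: "real \<Rightarrow> complex"
  assumes loc: "\<And>a b. a < b \<Longrightarrow> g integrable_on {a..b}" and "\<epsilon> > 0"
    and bound: "\<And>t. \<bar>t\<bar> \<ge> T \<Longrightarrow> norm (g t) \<le> K * exp (- \<epsilon> * \<bar>t\<bar>)"
  shows "g integrable_on UNIV"
proof -
  have loc': "g integrable_on {a..b}" for a b
    using loc[of a b] integrable_on_refl[of g a] by (cases "a < b"; cases "a = b") auto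
  define S where "S = max T 0"
  have ex: "(\<lambda>t. K * exp (- \<epsilon> * \<bar>t\<bar>)) integrable_on UNIV"
    using has_integral_exp_abs_shift[OF \<open>\<epsilon> > 0\<close>, of 0] by (auto simp: integrable_on_def intro: has_integral_mult_right)
  have ab: "(\<lambda>t. K * exp (- \<epsilon> * \<bar>t\<bar>)) absolutely_integrable_on UNIV" if "K \<ge> 0"
    using ex that by (intro nonnegative_absolutely_integrable_1) auto
  have K0: "K \<ge> 0" using bound[of S] norm_ge_zero[of "g S"] unfolding S_def
    by (smt (verit) exp_gt_zero mult_neg_pos)
  have ex': "(\<lambda>t. K * exp (- \<epsilon> * \<bar>t\<bar>)) integrable_on A" if "A \<in> sets borel" for A
    using set_integrable_subset[OF ab[OF K0], of A] that by (auto intro: set_lebesgue_integral_eq_integral(1))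
  have 1: "g integrable_on {S..}"
  proof (rule integrable_on_all_intervals_integrable_bound)
    show "(\<lambda>t. K * exp (- \<epsilon> * \<bar>t\<bar>)) integrable_on {S..}" by (rule ex') auto
    show "norm (g t) \<le> K * exp (- \<epsilon> * \<bar>t\<bar>)" if "t \<in> {S..}" for t using that by (intro bound) (auto simp: S_def)
    show "(\<lambda>x. if x \<in> {S..} then g x else 0) integrable_on cbox a b" for a b
    proof -
      have "{S..} \<inter> cbox a b = {max S a..b}" by auto
      then show ?thesis unfolding integrable_restrict_Int using loc' by simp
    qed
  qed
  have 2: "g integrable_on {..-S}"
  proof (rule integrable_on_all_intervals_integrable_bound)
    show "(\<lambda>t. K * exp (- \<epsilon> * \<bar>t\<bar>)) integrable_on {..-S}" by (rule ex') auto
    show "norm (g t) \<le> K * exp (- \<epsilon> * \<bar>t\<bar>)" if "t \<in> {..-S}" for t using that by (intro bound) (auto simp: S_def)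
    show "(\<lambda>x. if x \<in> {..-S} then g x else 0) integrable_on cbox a b" for a b
    proof -
      have "{..-S} \<inter> cbox a b = {a..min b (-S)}" by auto
      then show ?thesis unfolding integrable_restrict_Int using loc' by simp
    qed
  qed
  have "{..-S} \<inter> {-S..S} = {-S}" "({..-S} \<union> {-S..S}) \<inter> {S..} \<subseteq> {S,-S}" by (auto simp: S_def)
  then have neg: "negligible ({..-S} \<inter> {-S..S})" "negligible (({..-S} \<union> {-S..S}) \<inter> {S..})"
    using negligible_subset[OF negligible_finite[of "{S, - S}"]] by simp_all
  have "UNIV = ({..-S} \<union> {-S..S}) \<union> {S..}" by auto
  then show ?thesis using integrable_Un[OF neg(2) integrable_Un[OF neg(1) 2 loc'] 1] by simp
qed

lemma integral_symmetric_limit: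
  fixes g :: "real \<Rightarrow> complex"
  assumes "g integrable_on UNIV"
  shows "((\<lambda>R. integral {-R..R} g) \<longlongrightarrow> integral UNIV g) at_top"
proof (rule tendstoI)
  fix r :: real assume "r > 0"
  then obtain B where B: "\<And>a b. ball 0 B \<subseteq> cbox a b \<Longrightarrow> norm (integral (cbox a b) g - integral UNIV g) < r"
    using integrable_integral[OF assms] unfolding has_integral_alt'[of g "integral UNIV g" UNIV] by simp metis
  have "norm (integral {-R..R} g - integral UNIV g) < r" if "R \<ge> B" for R
  proof -
    have "ball 0 B \<subseteq> cbox (-R) R" using that by (auto simp: dist_norm)
    then show ?thesis using B[of "-R" R] by simp
  qed
  then show "\<forall>\<^sub>F R in at_top. dist (integral {-R..R} g) (integral UNIV g) < r"
    unfolding dist_norm eventually_at_top_linorder by blast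
qed

text \<open>Wide enough to contain both the Bessel contours and the straight lines to which they are
  shifted, whose real part exceeds what \<open>bessel_contour\<close> admits at the ends.\<close>

definition vertical_contour :: "complex set \<Rightarrow> (real \<Rightarrow> complex) \<Rightarrow> bool" where
  "vertical_contour P \<gamma> \<longleftrightarrow> (\<forall>a b. \<gamma> piecewise_C1_differentiable_on {a..b}) \<and>
     (\<exists>\<sigma> T. \<forall>t. \<bar>t\<bar> \<ge> T \<longrightarrow> \<gamma> t = Complex \<sigma> t) \<and> P \<subseteq> left_side \<gamma>"

text \<open>A connected component relates only points of the set itself, so a point on the left side
  cannot lie on the curve.\<close>

lemma vertical_contour_disjoint:
  assumes "vertical_contour P \<gamma>" shows "\<gamma> t \<in> - P"
proof
  assume "\<gamma> t \<in> P"
  then have "\<forall>\<^sub>F r in at_bot. connected_component (- range \<gamma>) (\<gamma> t) (complex_of_real r)"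
    using assms unfolding vertical_contour_def left_side_def by blast
  then obtain r where "connected_component (- range \<gamma>) (\<gamma> t) (complex_of_real r)"
    using eventually_happens trivial_limit_at_bot_linorder by blast
  then show False using connected_component_in by blast
qed

lemma vertical_line_contour:
  assumes "\<And>p. p \<in> P \<Longrightarrow> Re p < \<sigma>"
  shows "vertical_contour P (Complex \<sigma>)"
  unfolding vertical_contour_def
proof (intro conjI allI exI[of _ \<sigma>] exI[of _ 0] impI)
  have [simp]: "((\<lambda>t. Complex \<sigma> t) has_vector_derivative \<i>) (at t)" for t
    unfolding Complex_eq by (auto intro!: derivative_eq_intros)
  have "Complex \<sigma> C1_differentiable_on {a..b}" for a b
    unfolding C1_differentiable_on_def by (intro exI[of _ "\<lambda>_. \<i>"]) auto
  then show "Complex \<sigma> piecewise_C1_differentiable_on {a..b}" for a b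
    by (rule C1_differentiable_imp_piecewise)
  show "P \<subseteq> left_side (Complex \<sigma>)"
  proof
    fix p assume p: "p \<in> P"
    have conv: "convex {z. Re z < \<sigma>}" by (rule convex_halfspace_Re_lt)
    have "connected_component (- range (Complex \<sigma>)) p (complex_of_real r)" if "r < \<sigma>" for r
      unfolding connected_component_def
      using assms[OF p] that by (intro exI[of _ "{z. Re z < \<sigma>}"]) (auto intro: convex_connected conv)
    then show "p \<in> left_side (Complex \<sigma>)" 
      unfolding left_side_def eventually_at_bot_linorder by (auto intro!: exI[of _ "\<sigma> - 1"])
  qed
qed auto

text \<open>Links the integral over the real parameter to contour integrals over paths on [0, 1],
  for which Cauchy's theorem is stated. The chain rule may fail at finitely many parameters, which
  do not affect the integral.\<close>

lemma has_contour_integral_affine: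
  fixes \<gamma> :: "real \<Rightarrow> complex"
  assumes \<gamma>: "\<gamma> piecewise_C1_differentiable_on {a..b}" and "a < b"
  shows "(f has_contour_integral I) (\<gamma> \<circ> (\<lambda>x. (b - a) * x + a)) \<longleftrightarrow>
     ((\<lambda>t. f (\<gamma> t) * vector_derivative \<gamma> (at t)) has_integral I) {a..b}"
proof -
  define m where "m = b - a"
  have m: "m > 0" using assms by (simp add: m_def)
  obtain S where S: "finite S" "\<gamma> C1_differentiable_on ({a..b} - S)" using \<gamma> by (auto simp: piecewise_C1_differentiable_on_def)
  define h where "h x = m * x + a" for x
  define S' where "S' = (\<lambda>t. (t - a) / m) ` S"
  have vd: "vector_derivative (\<gamma> \<circ> h) (at x) = m *\<^sub>R vector_derivative \<gamma> (at (h x))" if "x \<in> {0..1} - S'" for x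
  proof -
    have "h x \<in> {a..b}" using that m unfolding h_def
      by (auto simp: m_def mult_left_le) (smt (verit) mult_left_le)
    moreover have "h x \<notin> S" using that m by (force simp: S'_def h_def image_iff)
    ultimately have "\<gamma> differentiable (at (h x))" using S(2) by (auto simp: C1_differentiable_on_eq)
    moreover have hd: "(h has_vector_derivative m) (at x)" 
      unfolding h_def by (auto intro!: derivative_eq_intros simp: has_real_derivative_iff_has_vector_derivative[symmetric])
    ultimately show ?thesis 
      by (subst vector_derivative_chain_at) (auto simp: differentiableI_vector vector_derivative_at)
  qed
  have "(f has_contour_integral I) (\<gamma> \<circ> h) \<longleftrightarrow> ((\<lambda>x. f (\<gamma> (h x)) * (m *\<^sub>R vector_derivative \<gamma> (at (h x)))) has_integral I) {0..1}"
    unfolding has_contour_integral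
    by (rule has_integral_spike_finite_eq[of S']) (use S in \<open>auto simp: S'_def[symmetric] vd\<close>, simp add: S'_def)
  also have "\<dots> \<longleftrightarrow> ((\<lambda>x. m *\<^sub>R (\<lambda>t. f (\<gamma> (t + a)) * vector_derivative \<gamma> (at (t + a))) (m * x)) has_integral I) ((\<lambda>x. x / m) ` {0..m})"
    using m by (simp add: h_def)
  also have "\<dots> \<longleftrightarrow> ((\<lambda>t. m *\<^sub>R (f (\<gamma> (t + a)) * vector_derivative \<gamma> (at (t + a)))) has_integral (m *\<^sub>R I)) {0..m}"
    using m by (subst has_integral_stretch_real_iff) auto
  also have "\<dots> \<longleftrightarrow> ((\<lambda>t. f (\<gamma> (t + a)) * vector_derivative \<gamma> (at (t + a))) has_integral I) {0..m}"
    using m by (simp add: scaleR_conv_of_real has_integral_mult_right_iff)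
  also have "\<dots> \<longleftrightarrow> ((\<lambda>t. f (\<gamma> t) * vector_derivative \<gamma> (at t)) has_integral I) {a..b}"
    by (subst (2) has_integral_shift_real_ivl_iff[where c = a]) (simp add: m_def)
  finally show ?thesis by (simp add: h_def[abs_def] m_def)
qed

text \<open>The range is a compact arc together with two closed half-lines. With an open complement,
  connected components are path components, so poles can be joined to the far left by actual
  paths.\<close>

lemma vertical_contour_closed_range:
  assumes "vertical_contour P \<gamma>" shows "closed (range \<gamma>)"
proof -
  obtain \<sigma> T0 where T0: "\<And>t. \<bar>t\<bar> \<ge> T0 \<Longrightarrow> \<gamma> t = Complex \<sigma> t" using assms by (auto simp: vertical_contour_def)
  define T where "T = max T0 0"
  have "continuous_on {-T..T} \<gamma>" using assms by (auto simp: vertical_contour_def piecewise_C1_differentiable_on_def)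
  then have 1: "closed (\<gamma> ` {-T..T})" using compact_continuous_image compact_imp_closed by blast
  have 2: "closed {z. Re z = \<sigma> \<and> T \<le> \<bar>Im z\<bar>}"
    by (intro closed_Collect_conj closed_Collect_eq closed_Collect_le continuous_intros)
  have "z \<in> range \<gamma>" if "Re z = \<sigma>" "T \<le> \<bar>Im z\<bar>" for z
    using T0[of "Im z"] that by (auto simp: T_def complex_eq_iff intro!: image_eqI[of _ _ "Im z"])
  moreover have "\<gamma> t \<in> \<gamma> ` {-T..T} \<or> (Re (\<gamma> t) = \<sigma> \<and> T \<le> \<bar>Im (\<gamma> t)\<bar>)" for t
    using T0[of t] by (cases "\<bar>t\<bar> \<ge> T") (auto simp: T_def intro!: imageI)
  ultimately have "range \<gamma> = \<gamma> ` {-T..T} \<union> {z. Re z = \<sigma> \<and> T \<le> \<bar>Im z\<bar>}" by auto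
  then show ?thesis using 1 2 by (metis closed_Un)
qed

text \<open>The part of the contour over \<open>{-R..R}\<close> is closed up far to the right, beyond compact paths that
  connect the finitely many relevant poles with points to the left of the contour.\<close>

lemma vertical_contour_closed_up:
  assumes \<gamma>: "vertical_contour P \<gamma>" and fin: "\<And>a. finite (P \<inter> {z. a \<le> Re z})"
    and \<sigma>: "\<And>t. \<bar>t\<bar> \<ge> T \<Longrightarrow> \<gamma> t = Complex \<sigma> t"
  obtains B where "\<And>\<sigma>1 R c. B \<le> \<sigma>1 \<Longrightarrow> B \<le> R \<Longrightarrow> 
      c = (\<gamma> \<circ> (\<lambda>x. (R - (- R)) * x + (- R))) +++ linepath (Complex \<sigma> R) (Complex \<sigma>1 R) +++
          linepath (Complex \<sigma>1 R) (Complex \<sigma>1 (-R)) +++ linepath (Complex \<sigma>1 (-R)) (Complex \<sigma> (-R)) \<Longrightarrow>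
      valid_path c \<and> pathfinish c = pathstart c \<and> path_image c \<subseteq> - P \<and> (\<forall>p\<in>P. winding_number c p = 0) \<and> T < R \<and> 0 < R"
proof -
  have cont: "continuous_on {-max T 0..max T 0} \<gamma>" using \<gamma> by (auto simp: vertical_contour_def piecewise_C1_differentiable_on_def)
  then have "bounded (\<gamma> ` {-max T 0..max T 0})" using compact_continuous_image compact_imp_bounded by blast
  then obtain B0 where B0: "B0 > 0" "\<And>t. t \<in> {-max T 0..max T 0} \<Longrightarrow> norm (\<gamma> t) \<le> B0" 
    unfolding bounded_pos by auto
  \<comment> \<open>A lower bound for the real part on the whole curve, including its vertical
    ends.\<close>
  define a where "a = - B0 - \<bar>\<sigma>\<bar>"
  have Re_ge: "a \<le> Re (\<gamma> t)" for t
  proof (cases "\<bar>t\<bar> \<ge> T")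
    case True then show ?thesis using \<sigma> B0 by (auto simp: a_def)
  next
    case False then have "norm (\<gamma> t) \<le> B0" by (intro B0) auto
    then show ?thesis using abs_Re_le_cmod[of "\<gamma> t"] by (auto simp: a_def)
  qed
  \<comment> \<open>Poles outside \<open>Q\<close> lie to the left of a half-plane that contains the
    closed-up curve, so its winding number there is 0. Only the finitely many poles in
    \<open>Q\<close> require a path.\<close>
  define Q where "Q = P \<inter> {z. a \<le> Re z}"
  have "\<exists>g. path g \<and> path_image g \<subseteq> - range \<gamma> \<and> pathstart g = p \<and> Re (pathfinish g) < a" if p: "p \<in> Q" for p
  proof -
    have "\<forall>\<^sub>F r in at_bot. connected_component (- range \<gamma>) p (complex_of_real r)"
      using p \<gamma> by (auto simp: Q_def vertical_contour_def left_side_def)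
    then have "\<forall>\<^sub>F r in at_bot. connected_component (- range \<gamma>) p (complex_of_real r) \<and> r \<le> a - 1"
      by (intro eventually_conj eventually_le_at_bot)
    then obtain r where r: "connected_component (- range \<gamma>) p (complex_of_real r)" "r \<le> a - 1"
      using eventually_happens trivial_limit_at_bot_linorder by blast
    have "open (- range \<gamma>)" using vertical_contour_closed_range[OF \<gamma>] by (simp add: open_Compl)
    then have "path_component (- range \<gamma>) p (complex_of_real r)"
      using r by (simp add: open_path_connected_component)
    then show ?thesis using r unfolding path_component_def by force
  qed
  then obtain g where g: "\<And>p. p \<in> Q \<Longrightarrow> path (g p) \<and> path_image (g p) \<subseteq> - range \<gamma> \<and> pathstart (g p) = p \<and> Re (pathfinish (g p)) < a"
    by metis
  have "finite Q" unfolding Q_def by (rule fin)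
  then have "bounded (\<Union>p\<in>Q. path_image (g p))" using g by (intro bounded_UN) (auto simp: bounded_path_image)
  then obtain B1 where B1: "B1 > 0" "\<And>z p. p \<in> Q \<Longrightarrow> z \<in> path_image (g p) \<Longrightarrow> norm z \<le> B1"
    unfolding bounded_pos by blast
  obtain B2 where B2: "\<And>p. p \<in> Q \<Longrightarrow> norm p \<le> B2"
    using finite_imp_bounded[OF \<open>finite Q\<close>] unfolding bounded_iff by blast
  \<comment> \<open>On the three added segments |Im z| = R or Re z = \<sigma>1, so |z| >
    \<open>B1\<close> there and the segments miss all the paths \<open>g p\<close>.\<close>
  define B where "B = B1 + \<bar>B2\<bar> + B0 + \<bar>\<sigma>\<bar> + \<bar>T\<bar> + 1"
  show ?thesis
  proof (rule that)
    fix \<sigma>1 R c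
    assume B: "B \<le> \<sigma>1" "B \<le> R" and c: "c = (\<gamma> \<circ> (\<lambda>x. (R - (- R)) * x + (- R))) +++ linepath (Complex \<sigma> R) (Complex \<sigma>1 R) +++
          linepath (Complex \<sigma>1 R) (Complex \<sigma>1 (-R)) +++ linepath (Complex \<sigma>1 (-R)) (Complex \<sigma> (-R))"
    define h where "h = \<gamma> \<circ> (\<lambda>x. (R - (- R)) * x + (- R))"
    have R: "T < R" "0 < R" "B1 < R" "B1 < \<sigma>1" "a \<le> \<sigma>" "a \<le> \<sigma>1" using B B0 B1(1) unfolding B_def a_def by linarith+
    have \<gamma>R: "\<gamma> R = Complex \<sigma> R" "\<gamma> (-R) = Complex \<sigma> (-R)" using \<sigma>[of R] \<sigma>[of "-R"] R by auto
    have "(\<gamma> \<circ> (\<lambda>x. (R - (- R)) *\<^sub>R x + (- R))) piecewise_C1_differentiable_on {0..1}"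
    proof (rule piecewise_C1_differentiable_affine)
      have "(\<lambda>x. (R - - R) * x + - R) ` {0..1} \<subseteq> {-R..R}"
        using R by (auto simp: mult_left_le)
      then show "\<gamma> piecewise_C1_differentiable_on (\<lambda>x. (R - - R) * x + - R) ` {0..1}"
        using \<gamma> piecewise_C1_differentiable_on_subset unfolding vertical_contour_def by blast
    qed
    then have vh: "valid_path h" by (simp add: h_def valid_path_def)
    have hs: "pathstart h = Complex \<sigma> (-R)" "pathfinish h = Complex \<sigma> R" 
      by (simp_all add: h_def pathstart_def pathfinish_def \<gamma>R)
    have himg: "path_image h \<subseteq> range \<gamma>" by (auto simp: h_def path_image_def)
    have vc: "valid_path c" and loop: "pathfinish c = pathstart c"
      unfolding c h_def[symmetric] by (auto intro!: valid_path_join vh simp: hs)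
    define L where "L = closed_segment (Complex \<sigma> R) (Complex \<sigma>1 R) \<union> closed_segment (Complex \<sigma>1 R) (Complex \<sigma>1 (-R))
        \<union> closed_segment (Complex \<sigma>1 (-R)) (Complex \<sigma> (-R))"
    have imgc: "path_image c \<subseteq> range \<gamma> \<union> L"
      unfolding c h_def[symmetric] L_def using himg by (auto simp: path_image_join hs)
    have L: "norm z > B1" "a \<le> Re z" if "z \<in> L" for z
    proof -
      have "\<bar>Im z\<bar> = R \<or> Re z = \<sigma>1"
        using that R by (auto simp: L_def closed_segment_same_Im closed_segment_same_Re)
      then show "norm z > B1" using abs_Im_le_cmod[of z] abs_Re_le_cmod[of z] R by auto
      have "L \<subseteq> {z. a \<le> Re z}" unfolding L_def
        using R by (intro Un_least closed_segment_subset convex_halfspace_Re_ge) auto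
      then show "a \<le> Re z" using that by auto
    qed
    have img_a: "path_image c \<subseteq> {z. a \<le> Re z}" using imgc L(2) Re_ge by blast
    have out: "winding_number c z = 0" if "Re z < a" for z
      using that by (intro winding_number_zero_outside[OF valid_path_imp_path[OF vc] convex_halfspace_Re_ge loop _ img_a]) auto
    have dis: "path_image (g p) \<inter> path_image c = {}" if "p \<in> Q" for p
      using g[OF that] B1(2)[OF that] imgc L(1) by fastforce
    have pin: "p \<in> path_image (g p)" if "p \<in> Q" for p using g[OF that] by (metis pathstart_in_path_image)
    have "winding_number c p = 0 \<and> p \<notin> path_image c" if p: "p \<in> P" for p
    proof (cases "p \<in> Q")
      case True
      \<comment> \<open>The winding number is constant along \<open>g p\<close>, which avoids the
        closed curve and ends to the left of it.\<close>
      have "winding_number c p = winding_number c (pathfinish (g p))"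
        using g[OF True] by (intro winding_number_eq[OF valid_path_imp_path[OF vc] loop pin[OF True] _ _ dis[OF True]])
          (auto simp: connected_path_image)
      then show ?thesis using out g[OF True] dis[OF True] pin[OF True] by auto
    next
      case False
      then have "Re p < a" using p by (auto simp: Q_def)
      then show ?thesis using out img_a by force
    qed
    then show "valid_path c \<and> pathfinish c = pathstart c \<and> path_image c \<subseteq> - P \<and> (\<forall>p\<in>P. winding_number c p = 0) \<and> T < R \<and> 0 < R"
      using vc loop R by auto
  qed
qed

text \<open>Cauchy's theorem is applied to the closed-up curve; its horizontal sides contribute
  O(exp (- \<epsilon> R)) and vanish as R grows with \<sigma>1 fixed. Integrability on the line is a
  premise of the second claim because the first claim, applied to the line itself, supplies
  it.\<close>

lemma vertical_contour_integral_line: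
  assumes hol: "f holomorphic_on - P" and P: "closed P" "\<And>a. finite (P \<inter> {z. a \<le> Re z})"
    and \<gamma>: "vertical_contour P \<gamma>" and "\<epsilon> > 0"
    and decay: "\<And>a b::real. \<exists>(K::real) (T::real). \<forall>s. a \<le> Re s \<and> Re s \<le> b \<and> \<bar>Im s\<bar> \<ge> T \<longrightarrow> norm (f s) \<le> K * exp (- \<epsilon> * \<bar>Im s\<bar>)"
  shows "(\<lambda>t. f (\<gamma> t) * vector_derivative \<gamma> (at t)) integrable_on UNIV"
    and "\<exists>B. \<forall>\<sigma>1\<ge>B. (\<lambda>t. f (Complex \<sigma>1 t)) integrable_on UNIV \<longrightarrow> 
           integral UNIV (\<lambda>t. f (\<gamma> t) * vector_derivative \<gamma> (at t)) = \<i> * integral UNIV (\<lambda>t. f (Complex \<sigma>1 t))"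
proof -
  define G where "G = (\<lambda>t. f (\<gamma> t) * vector_derivative \<gamma> (at t))"
  have pw: "\<gamma> piecewise_C1_differentiable_on {a..b}" for a b using \<gamma> by (auto simp: vertical_contour_def)
  obtain \<sigma> T where \<sigma>: "\<And>t. \<bar>t\<bar> \<ge> T \<Longrightarrow> \<gamma> t = Complex \<sigma> t" using \<gamma> by (auto simp: vertical_contour_def)
  have oP: "open (- P)" using P by (simp add: open_Compl)
  have loc: "G integrable_on {a..b}" if "a < b" for a b
  proof -
    define h where "h = \<gamma> \<circ> (\<lambda>x. (b - a) * x + a)"
    have "(\<gamma> \<circ> (\<lambda>x. (b - a) *\<^sub>R x + a)) piecewise_C1_differentiable_on {0..1}"
    proof (rule piecewise_C1_differentiable_affine)
      have "(\<lambda>x. (b - a) * x + a) ` {0..1} \<subseteq> {a..b}" using that by auto (smt (verit) mult_left_le)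
      then show "\<gamma> piecewise_C1_differentiable_on (\<lambda>x. (b - a) * x + a) ` {0..1}"
        using pw piecewise_C1_differentiable_on_subset by blast
    qed
    then have "valid_path h" by (simp add: h_def valid_path_def)
    moreover have "path_image h \<subseteq> - P" using vertical_contour_disjoint[OF \<gamma>] by (auto simp: h_def path_image_def)
    ultimately have "f contour_integrable_on h" using contour_integrable_holomorphic_simple[OF hol oP] by blast
    then show ?thesis
      unfolding contour_integrable_on_def h_def has_contour_integral_affine[OF pw that] G_def by (auto simp: integrable_on_def)
  qed
  have vd: "vector_derivative \<gamma> (at t) = \<i>" if "\<bar>t\<bar> > T" for t
  proof (rule vector_derivative_at)
    have "((\<lambda>t. Complex \<sigma> t) has_vector_derivative \<i>) (at t)"
      unfolding Complex_eq by (auto intro!: derivative_eq_intros)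
    moreover have "open {t. \<bar>t\<bar> > T}" by (intro open_Collect_less continuous_intros)
    ultimately show "(\<gamma> has_vector_derivative \<i>) (at t)"
      by (rule has_vector_derivative_transform_within_open) (use that \<sigma> in auto)
  qed
  obtain K T1 where K: "\<And>s. \<sigma> \<le> Re s \<and> Re s \<le> \<sigma> \<and> \<bar>Im s\<bar> \<ge> T1 \<Longrightarrow> norm (f s) \<le> K * exp (- \<epsilon> * \<bar>Im s\<bar>)"
    using decay[of \<sigma> \<sigma>] by blast
  have int: "G integrable_on UNIV"
  proof (rule integrable_exp_tail[OF loc \<open>\<epsilon> > 0\<close>])
    \<comment> \<open>The derivative of \<gamma> is known to be i only for |t| > \<open>T\<close>,
      hence the added 1.\<close>
    fix t assume "max (\<bar>T\<bar> + 1) T1 \<le> \<bar>t\<bar>"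
    then show "norm (G t) \<le> K * exp (- \<epsilon> * \<bar>t\<bar>)"
      using K[of "Complex \<sigma> t"] \<sigma>[of t] vd[of t] by (auto simp: G_def norm_mult)
  qed
  then show "(\<lambda>t. f (\<gamma> t) * vector_derivative \<gamma> (at t)) integrable_on UNIV" by (simp add: G_def)
  obtain B where B: "\<And>\<sigma>1 R c. B \<le> \<sigma>1 \<Longrightarrow> B \<le> R \<Longrightarrow> 
      c = (\<gamma> \<circ> (\<lambda>x. (R - (- R)) * x + (- R))) +++ linepath (Complex \<sigma> R) (Complex \<sigma>1 R) +++
          linepath (Complex \<sigma>1 R) (Complex \<sigma>1 (-R)) +++ linepath (Complex \<sigma>1 (-R)) (Complex \<sigma> (-R)) \<Longrightarrow>
      valid_path c \<and> pathfinish c = pathstart c \<and> path_image c \<subseteq> - P \<and> (\<forall>p\<in>P. winding_number c p = 0) \<and> T < R \<and> 0 < R"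
    using vertical_contour_closed_up[OF \<gamma> P(2) \<sigma>] by blast
  show "\<exists>B. \<forall>\<sigma>1\<ge>B. (\<lambda>t. f (Complex \<sigma>1 t)) integrable_on UNIV \<longrightarrow> 
           integral UNIV (\<lambda>t. f (\<gamma> t) * vector_derivative \<gamma> (at t)) = \<i> * integral UNIV (\<lambda>t. f (Complex \<sigma>1 t))"
  proof (intro exI[of _ B] allI impI)
    fix \<sigma>1 assume \<sigma>1: "B \<le> \<sigma>1" and int1: "(\<lambda>t. f (Complex \<sigma>1 t)) integrable_on UNIV"
    define m M where "m = min \<sigma> \<sigma>1" and "M = max \<sigma> \<sigma>1"
    obtain K2 T2 where K2: "\<And>s. m \<le> Re s \<and> Re s \<le> M \<and> \<bar>Im s\<bar> \<ge> T2 \<Longrightarrow> norm (f s) \<le> K2 * exp (- \<epsilon> * \<bar>Im s\<bar>)"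
      using decay[of m M] by blast
    have bound: "norm (integral {-R..R} G - \<i> * integral {-R..R} (\<lambda>t. f (Complex \<sigma>1 t))) \<le> 2 * (\<bar>K2\<bar> * exp (- \<epsilon> * R) * \<bar>\<sigma>1 - \<sigma>\<bar>)"
      if R: "R \<ge> max B T2" for R
    proof -
      define l1 where "l1 = linepath (Complex \<sigma> R) (Complex \<sigma>1 R)"
      define l2 where "l2 = linepath (Complex \<sigma>1 R) (Complex \<sigma>1 (-R))"
      define l3 where "l3 = linepath (Complex \<sigma>1 (-R)) (Complex \<sigma> (-R))"
      define h where "h = \<gamma> \<circ> (\<lambda>x. (R - (- R)) * x + (- R))"
      define c where "c = h +++ l1 +++ l2 +++ l3"
      have c: "valid_path c" "pathfinish c = pathstart c" "path_image c \<subseteq> - P" "\<And>p. p \<in> P \<Longrightarrow> winding_number c p = 0" and R': "T < R" "0 < R"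
        using B[OF \<sigma>1, of R c] R by (auto simp: c_def h_def l1_def l2_def l3_def)
      have "(f has_contour_integral 0) c"
        by (rule Cauchy_theorem_global[OF oP hol c(1-3)]) (use c(4) in auto)
      have ends: "pathfinish h = Complex \<sigma> R" using \<sigma>[of R] R' by (simp add: h_def pathfinish_def)
      have "path_image c = path_image h \<union> path_image l1 \<union> path_image l2 \<union> path_image l3"
        unfolding c_def by (simp add: path_image_join ends l1_def l2_def l3_def Un_assoc)
      then have sub: "path_image h \<subseteq> - P" "path_image l1 \<subseteq> - P" "path_image l2 \<subseteq> - P" "path_image l3 \<subseteq> - P"
        using c(3) by auto
      have vh: "valid_path h" 
        using c(1) unfolding c_def by (rule valid_path_join_D1)
      have v: "valid_path l1" "valid_path l2" "valid_path l3" by (auto simp: l1_def l2_def l3_def)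
      have ci: "f contour_integrable_on h" "f contour_integrable_on l1" "f contour_integrable_on l2" "f contour_integrable_on l3"
        using contour_integrable_holomorphic_simple[OF hol oP] sub v vh by auto
      have "0 = contour_integral h f + (contour_integral l1 f + (contour_integral l2 f + contour_integral l3 f))"
      proof -
        have "contour_integral c f = 0" using \<open>(f has_contour_integral 0) c\<close> contour_integral_unique by blast
        moreover have "contour_integral c f = contour_integral h f + (contour_integral l1 f + (contour_integral l2 f + contour_integral l3 f))"
          unfolding c_def using ci v vh
          by (auto intro!: contour_integral_unique has_contour_integral_join has_contour_integral_integral valid_path_join simp: l1_def l2_def l3_def)
        ultimately show ?thesis by simp
      qed
      moreover have "contour_integral h f = integral {-R..R} G"
      proof -
        have "(f has_contour_integral contour_integral h f) h" using ci(1) by (rule has_contour_integral_integral)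
        then have "(G has_integral contour_integral h f) {-R..R}"
          unfolding h_def G_def using R' by (subst (asm) (1) has_contour_integral_affine[OF pw]) auto
        then show ?thesis by (simp add: integral_unique)
      qed
      moreover have "contour_integral l2 f = - \<i> * integral {-R..R} (\<lambda>t. f (Complex \<sigma>1 t))"
      proof -
        define l where "l = linepath (Complex \<sigma>1 (-R)) (Complex \<sigma>1 R)"
        have l2: "l2 = reversepath l" by (simp add: l_def l2_def)
        have vl: "valid_path l" by (simp add: l_def)
        have "f contour_integrable_on l" using ci(3) vl unfolding l2 by (metis contour_integrable_reversepath_eq)
        then have "(f has_contour_integral contour_integral l f) l" by (rule has_contour_integral_integral)
        then have "((\<lambda>t. f (Complex \<sigma>1 t)) has_integral (- \<i> * contour_integral l f)) {-R..R}"
          unfolding l_def using R' by (subst (asm) (1) has_contour_integral_linepath_same_Re_iff) auto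
        then have "integral {-R..R} (\<lambda>t. f (Complex \<sigma>1 t)) = - \<i> * contour_integral l f" by (rule integral_unique)
        moreover have "contour_integral l2 f = - contour_integral l f" unfolding l2 by (rule contour_integral_reversepath[OF vl])
        ultimately show ?thesis by simp
      qed
      ultimately have "integral {-R..R} G - \<i> * integral {-R..R} (\<lambda>t. f (Complex \<sigma>1 t)) = - (contour_integral l1 f + contour_integral l3 f)"
        by (simp add: algebra_simps)
      moreover have "norm (contour_integral l1 f) \<le> \<bar>K2\<bar> * exp (- \<epsilon> * R) * norm (Complex \<sigma>1 R - Complex \<sigma> R)"
        unfolding l1_def
      proof (rule contour_integral_bound_linepath)
        fix s assume "s \<in> closed_segment (Complex \<sigma> R) (Complex \<sigma>1 R)"
        then have "Re s \<in> closed_segment \<sigma> \<sigma>1" "Im s = R" by (auto simp: closed_segment_same_Im)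
        then have "norm (f s) \<le> K2 * exp (- \<epsilon> * \<bar>R\<bar>)" using K2[of s] R R' by (auto simp: m_def M_def closed_segment_eq_real_ivl split: if_splits)
        also have "\<dots> \<le> \<bar>K2\<bar> * exp (- \<epsilon> * R)" using R' by (auto intro!: mult_right_mono)
        finally show "norm (f s) \<le> \<bar>K2\<bar> * exp (- \<epsilon> * R)" .
      qed (use ci in \<open>auto simp: l1_def\<close>)
      moreover have "norm (contour_integral l3 f) \<le> \<bar>K2\<bar> * exp (- \<epsilon> * R) * norm (Complex \<sigma> (-R) - Complex \<sigma>1 (-R))"
        unfolding l3_def
      proof (rule contour_integral_bound_linepath)
        fix s assume "s \<in> closed_segment (Complex \<sigma>1 (-R)) (Complex \<sigma> (-R))"
        then have "Re s \<in> closed_segment \<sigma>1 \<sigma>" "Im s = -R" by (auto simp: closed_segment_same_Im)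
        then have "norm (f s) \<le> K2 * exp (- \<epsilon> * \<bar>-R\<bar>)" using K2[of s] R R' by (auto simp: m_def M_def closed_segment_eq_real_ivl split: if_splits)
        also have "\<dots> \<le> \<bar>K2\<bar> * exp (- \<epsilon> * R)" using R' by (auto intro!: mult_right_mono)
        finally show "norm (f s) \<le> \<bar>K2\<bar> * exp (- \<epsilon> * R)" .
      qed (use ci in \<open>auto simp: l3_def\<close>)
      moreover have "norm (Complex \<sigma>1 R - Complex \<sigma> R) = \<bar>\<sigma>1 - \<sigma>\<bar>" "norm (Complex \<sigma> (-R) - Complex \<sigma>1 (-R)) = \<bar>\<sigma>1 - \<sigma>\<bar>"
        by (auto simp: cmod_def)
      ultimately show ?thesis 
        using norm_triangle_ineq[of "contour_integral l1 f" "contour_integral l3 f"] by (simp only: norm_minus_cancel)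
    qed
    have lim0: "((\<lambda>R. 2 * (\<bar>K2\<bar> * exp (- \<epsilon> * R) * \<bar>\<sigma>1 - \<sigma>\<bar>)) \<longlongrightarrow> 2 * (\<bar>K2\<bar> * 0 * \<bar>\<sigma>1 - \<sigma>\<bar>)) at_top"
    proof (intro tendsto_intros)
      have "filterlim (\<lambda>R. - \<epsilon> * R) at_bot at_top" 
        using \<open>\<epsilon> > 0\<close> by (simp add: filterlim_uminus_at_bot filterlim_tendsto_pos_mult_at_top[OF tendsto_const _ filterlim_ident])
      then show "((\<lambda>R. exp (- \<epsilon> * R)) \<longlongrightarrow> 0) at_top" by (rule filterlim_compose[OF exp_at_bot])
    qed
    have "((\<lambda>R. integral {-R..R} G - \<i> * integral {-R..R} (\<lambda>t. f (Complex \<sigma>1 t))) \<longlongrightarrow> 0) at_top"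
      by (rule Lim_null_comparison[OF _ lim0[simplified]]) (use bound in \<open>auto simp: eventually_at_top_linorder intro!: exI[of _ "max B T2"]\<close>)
    moreover have "((\<lambda>R. integral {-R..R} G - \<i> * integral {-R..R} (\<lambda>t. f (Complex \<sigma>1 t))) \<longlongrightarrow> integral UNIV G - \<i> * integral UNIV (\<lambda>t. f (Complex \<sigma>1 t))) at_top"
      by (intro tendsto_intros integral_symmetric_limit int int1)
    ultimately have "integral UNIV G - \<i> * integral UNIV (\<lambda>t. f (Complex \<sigma>1 t)) = 0"
      using tendsto_unique trivial_limit_at_top_linorder by blast
    then show "integral UNIV (\<lambda>t. f (\<gamma> t) * vector_derivative \<gamma> (at t)) = \<i> * integral UNIV (\<lambda>t. f (Complex \<sigma>1 t))"
      by (simp add: G_def)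
  qed
qed

text \<open>The comparison reaches only lines beyond a bound that depends on the curve. Both
  \<gamma> and the line Re s = \<sigma> are therefore compared with a third line beyond both of
  their bounds.\<close>

lemma vertical_contour_integral_eq:
  assumes hol: "f holomorphic_on - P" and P: "closed P" "\<And>a. finite (P \<inter> {z. a \<le> Re z})" "\<And>p. p \<in> P \<Longrightarrow> Re p < \<sigma>0"
    and \<gamma>: "vertical_contour P \<gamma>" and \<epsilon>: "\<epsilon> > 0"
    and decay: "\<And>a b::real. \<exists>(K::real) (T::real). \<forall>s. a \<le> Re s \<and> Re s \<le> b \<and> \<bar>Im s\<bar> \<ge> T \<longrightarrow> norm (f s) \<le> K * exp (- \<epsilon> * \<bar>Im s\<bar>)"
    and \<sigma>: "\<sigma>0 \<le> \<sigma>"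
  shows "integral UNIV (\<lambda>t. f (\<gamma> t) * vector_derivative \<gamma> (at t)) = \<i> * integral UNIV (\<lambda>t. f (Complex \<sigma> t))"
    and "(\<lambda>t. f (Complex \<sigma> t)) integrable_on UNIV"
proof -
  have vd: "vector_derivative (Complex x) (at t) = \<i>" for x t
    by (rule vector_derivative_at) (unfold Complex_eq, auto intro!: derivative_eq_intros)
  have line: "vertical_contour P (Complex x)" if "\<sigma>0 \<le> x" for x
    by (rule vertical_line_contour) (use P(3) that in force)
  have intx: "(\<lambda>t. f (Complex x t)) integrable_on UNIV" if "\<sigma>0 \<le> x" for x
  proof -
    have "(\<lambda>t. f (Complex x t) * vector_derivative (Complex x) (at t)) integrable_on UNIV"
      by (rule vertical_contour_integral_line(1)[OF hol P(1,2) line[OF that] \<epsilon> decay])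
    then show ?thesis unfolding vd by (simp add: integrable_on_cmult_right_iff mult.commute)
  qed
  show "(\<lambda>t. f (Complex \<sigma> t)) integrable_on UNIV" by (rule intx[OF \<sigma>])
  obtain B1 where B1: "\<And>x. x \<ge> B1 \<Longrightarrow> (\<lambda>t. f (Complex x t)) integrable_on UNIV \<Longrightarrow>
       integral UNIV (\<lambda>t. f (\<gamma> t) * vector_derivative \<gamma> (at t)) = \<i> * integral UNIV (\<lambda>t. f (Complex x t))"
    using vertical_contour_integral_line(2)[OF hol P(1,2) \<gamma> \<epsilon> decay] by blast
  obtain B2 where B2: "\<And>x. x \<ge> B2 \<Longrightarrow> (\<lambda>t. f (Complex x t)) integrable_on UNIV \<Longrightarrow>
       integral UNIV (\<lambda>t. f (Complex \<sigma> t) * vector_derivative (Complex \<sigma>) (at t)) = \<i> * integral UNIV (\<lambda>t. f (Complex x t))"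
    using vertical_contour_integral_line(2)[OF hol P(1,2) line[OF \<sigma>] \<epsilon> decay] by blast
  define x where "x = max \<sigma>0 (max B1 B2)"
  have "integral UNIV (\<lambda>t. f (\<gamma> t) * vector_derivative \<gamma> (at t)) = integral UNIV (\<lambda>t. f (Complex \<sigma> t) * vector_derivative (Complex \<sigma>) (at t))"
    using B1[of x] B2[of x] intx[of x] by (simp add: x_def)
  then show "integral UNIV (\<lambda>t. f (\<gamma> t) * vector_derivative \<gamma> (at t)) = \<i> * integral UNIV (\<lambda>t. f (Complex \<sigma> t))"
    by (simp add: vd mult.commute)
qed

section \<open>The Mellin--Barnes integral\<close>

definition Gamma_poles :: "nat \<Rightarrow> (nat \<Rightarrow> complex) \<Rightarrow> complex set" where
  "Gamma_poles n lam = (\<Union>l\<in>{1..n}. range (\<lambda>k. lam l - of_nat k))"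

lemma closed_Gamma_poles: "closed (Gamma_poles n lam)"
proof -
  have "closed (range (\<lambda>k. w - of_nat k :: complex))" for w
  proof -
    have "range (\<lambda>k. w - of_nat k :: complex) = (\<lambda>z. w - z) -` range of_nat"
      by (auto simp: image_iff algebra_simps)
    moreover have "closed ((\<lambda>z. w - z) -` (range of_nat :: complex set))"
      by (intro continuous_closed_vimage closed_of_nat_image) (auto intro!: continuous_intros)
    ultimately show ?thesis by simp
  qed
  then show ?thesis unfolding Gamma_poles_def by (intro closed_UN) auto
qed

lemma finite_Gamma_poles_right: "finite (Gamma_poles n lam \<inter> {z. a \<le> Re z})"
proof -
  have fin: "finite (range (\<lambda>k. w - of_nat k :: complex) \<inter> {z. a \<le> Re z})" for w
  proof (rule finite_subset)
    show "range (\<lambda>k. w - of_nat k :: complex) \<inter> {z. a \<le> Re z} \<subseteq> (\<lambda>k. w - of_nat k) ` {..nat \<lceil>Re w - a\<rceil>}"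
    proof clarify
      fix k assume "a \<le> Re (w - of_nat k)"
      then have "real k \<le> Re w - a" by simp
      then have "k \<le> nat \<lceil>Re w - a\<rceil>" by linarith
      then show "w - of_nat k \<in> (\<lambda>k. w - of_nat k) ` {..nat \<lceil>Re w - a\<rceil>}" by blast
    qed
  qed auto
  have *: "Gamma_poles n lam \<inter> {z. a \<le> Re z} = (\<Union>l\<in>{1..n}. range (\<lambda>k. lam l - of_nat k) \<inter> {z. a \<le> Re z})"
    unfolding Gamma_poles_def by blast
  show ?thesis unfolding * by (intro finite_UN_I fin) simp
qed

lemma max_norm_ge: "l \<in> {1..n} \<Longrightarrow> norm (lam l) \<le> max_norm n lam"
  unfolding max_norm_def by (intro Max_ge) auto

lemma max_norm_nonneg: "n \<ge> 1 \<Longrightarrow> 0 \<le> max_norm n lam"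
  using order_trans[OF norm_ge_zero max_norm_ge[of 1 n lam]] by simp

lemma Re_Gamma_poles_less: "p \<in> Gamma_poles n lam \<Longrightarrow> Re p < max_norm n lam + 1"
proof -
  assume "p \<in> Gamma_poles n lam"
  then obtain l k where lk: "l \<in> {1..n}" "p = lam l - of_nat k" by (auto simp: Gamma_poles_def)
  show ?thesis using max_norm_ge[OF lk(1), of lam] complex_Re_le_cmod[of "lam l"] lk(2) by simp
qed

definition Gamma_prod :: "nat \<Rightarrow> (nat \<Rightarrow> complex) \<Rightarrow> complex \<Rightarrow> complex" where
  "Gamma_prod n lam s = (\<Prod>l=1..n. Gamma (s - lam l))"

lemma holomorphic_Gamma_prod: "Gamma_prod n lam holomorphic_on - Gamma_poles n lam"
  unfolding Gamma_prod_def
proof (intro holomorphic_intros)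
  fix l z assume l: "l \<in> {1..n}" "z \<in> - Gamma_poles n lam"
  show "z - lam l \<notin> \<int>\<^sub>\<le>\<^sub>0"
  proof
    assume "z - lam l \<in> \<int>\<^sub>\<le>\<^sub>0"
    then obtain k where "z - lam l = - of_nat k" by (elim nonpos_Ints_cases') auto
    then have "z = lam l - of_nat k" by (simp add: algebra_simps)
    then show False using l unfolding Gamma_poles_def by blast
  qed
qed

definition mellin_kernel :: "nat \<Rightarrow> (nat \<Rightarrow> complex) \<Rightarrow> complex \<Rightarrow> complex \<Rightarrow> complex" where
  "mellin_kernel n lam z s = Gamma_prod n lam s * exp (- of_nat n * s * Ln z)"

text \<open>The reference line lies to the right of all poles, and \<open>mellin_barnes_line\<close>
  allows any line further right. The factor i from ds has been cancelled against 2 pi i.\<close>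

definition mellin_barnes :: "nat \<Rightarrow> (nat \<Rightarrow> complex) \<Rightarrow> complex \<Rightarrow> complex" where
  "mellin_barnes n lam z =
     1 / (2 * of_real pi) * integral UNIV (\<lambda>t. mellin_kernel n lam z (Complex (max_norm n lam + 1) t))"

section \<open>Exponential decay of the Mellin kernel\<close>

lemma norm_exp_Ln: 
  "norm (exp (- of_nat n * s * Ln z)) = exp (real n * (Im s * Im (Ln z) - Re s * Re (Ln z)))"
  by (simp add: algebra_simps)

text \<open>The power z^(-ns) grows at most like exp (n |Im s| |Arg z|) on vertical lines, while the
  Gamma product decays like exp (- n \<phi> |Im s|) for any \<phi> < pi/2; an angle \<phi> between
  \<theta> and pi/2 leaves decay. K and T are uniform in z, for the sake of locally uniform
  convergence.\<close>

lemma mellin_kernel_decay: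
  assumes "n \<ge> 1" "\<theta> < pi / 2"
  shows "\<exists>\<epsilon>>0::real. \<forall>(a::real) (b::real) (L::real). \<exists>(K::real) (T::real). \<forall>s z. a \<le> Re s \<and> Re s \<le> b \<and> \<bar>Im s\<bar> \<ge> T \<and> \<bar>Im (Ln z)\<bar> \<le> \<theta> \<and> \<bar>Re (Ln z)\<bar> \<le> L \<longrightarrow>
           norm (mellin_kernel n lam z s) \<le> K * exp (- \<epsilon> * \<bar>Im s\<bar>)"
proof -
  \<comment> \<open>For negative \<theta> no z satisfies the condition on Im (Ln z); the maximum
    spares a separate case.\<close>
  define \<theta>' where "\<theta>' = max \<theta> 0"
  have \<theta>': "0 \<le> \<theta>'" "\<theta>' < pi / 2" using assms by (simp_all add: \<theta>'_def max_def)
  define \<phi> where "\<phi> = (\<theta>' + pi / 2) / 2"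
  have \<phi>: "0 < \<phi>" "\<phi> < pi / 2" "\<theta>' < \<phi>" using \<theta>' pi_gt_zero by (auto simp: \<phi>_def)
  define \<epsilon> where "\<epsilon> = n * (\<phi> - \<theta>')"
  show ?thesis
  proof (rule exI[of _ \<epsilon>], intro conjI allI)
    show "\<epsilon> > 0" using \<phi> assms by (simp add: \<epsilon>_def)
    fix a b L :: real
    obtain K T where K: "K \<ge> 0" "\<And>s. a \<le> Re s \<and> Re s \<le> b \<and> \<bar>Im s\<bar> \<ge> T \<Longrightarrow> 
        norm (Gamma_prod n lam s) \<le> K * exp (- (n * \<phi>) * \<bar>Im s\<bar>)"
      using prod_Gamma_strip_decay[of "{1..n}" \<phi> a b lam] \<phi> by (auto simp: Gamma_prod_def)
    define M where "M = n * (max \<bar>a\<bar> \<bar>b\<bar> * L)"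
    show "\<exists>(K::real) (T::real). \<forall>s z. a \<le> Re s \<and> Re s \<le> b \<and> \<bar>Im s\<bar> \<ge> T \<and> \<bar>Im (Ln z)\<bar> \<le> \<theta> \<and> \<bar>Re (Ln z)\<bar> \<le> L \<longrightarrow>
           norm (mellin_kernel n lam z s) \<le> K * exp (- \<epsilon> * \<bar>Im s\<bar>)"
    proof (rule exI[of _ "K * exp M"], rule exI[of _ T], intro allI impI)
      fix s z assume s: "a \<le> Re s \<and> Re s \<le> b \<and> \<bar>Im s\<bar> \<ge> T \<and> \<bar>Im (Ln z)\<bar> \<le> \<theta> \<and> \<bar>Re (Ln z)\<bar> \<le> L"
      have "Im s * Im (Ln z) \<le> \<bar>Im s\<bar> * \<bar>Im (Ln z)\<bar>" by (metis abs_ge_self abs_mult)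
      also have "\<dots> \<le> \<bar>Im s\<bar> * \<theta>'" using s by (intro mult_left_mono) (auto simp: \<theta>'_def)
      finally have 1: "Im s * Im (Ln z) \<le> \<bar>Im s\<bar> * \<theta>'" .
      have "- (Re s * Re (Ln z)) \<le> \<bar>Re s\<bar> * \<bar>Re (Ln z)\<bar>" by (metis abs_ge_minus_self abs_mult)
      also have "\<dots> \<le> max \<bar>a\<bar> \<bar>b\<bar> * L" using s by (intro mult_mono) auto
      finally have 2: "Im s * Im (Ln z) - Re s * Re (Ln z) \<le> \<bar>Im s\<bar> * \<theta>' + max \<bar>a\<bar> \<bar>b\<bar> * L" using 1 by linarith
      have "real n * (Im s * Im (Ln z) - Re s * Re (Ln z)) \<le> real n * (\<bar>Im s\<bar> * \<theta>' + max \<bar>a\<bar> \<bar>b\<bar> * L)"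
        by (intro mult_left_mono 2) auto
      then have "norm (exp (- of_nat n * s * Ln z)) \<le> exp (real n * (\<bar>Im s\<bar> * \<theta>') + M)"
        unfolding norm_exp_Ln M_def by (simp add: algebra_simps)
      then have "norm (mellin_kernel n lam z s) \<le> K * exp (- (n * \<phi>) * \<bar>Im s\<bar>) * exp (real n * (\<bar>Im s\<bar> * \<theta>') + M)"
        using K s unfolding mellin_kernel_def norm_mult by (intro mult_mono) auto
      also have "\<dots> = K * exp M * exp (- \<epsilon> * \<bar>Im s\<bar>)"
        by (simp add: mult_exp_exp \<epsilon>_def algebra_simps)
      finally show "norm (mellin_kernel n lam z s) \<le> K * exp M * exp (- \<epsilon> * \<bar>Im s\<bar>)" .
    qed
  qed
qed

lemma abs_Im_Ln_less: "Re z > 0 \<Longrightarrow> \<bar>Im (Ln z)\<bar> < pi / 2"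
  using Re_Ln_pos_lt[of z] by (cases "z = 0") auto

lemma mellin_kernel_decay_strip:
  assumes "n \<ge> 1" "Re z > 0"
  obtains \<epsilon> where "\<epsilon> > 0" "\<And>a b::real. \<exists>(K::real) (T::real). \<forall>s. a \<le> Re s \<and> Re s \<le> b \<and> \<bar>Im s\<bar> \<ge> T \<longrightarrow> norm (mellin_kernel n lam z s) \<le> K * exp (- \<epsilon> * \<bar>Im s\<bar>)"
proof -
  obtain \<epsilon> where \<epsilon>: "\<epsilon> > 0" "\<And>a b L. \<exists>(K::real) (T::real). \<forall>s w. a \<le> Re s \<and> Re s \<le> b \<and> \<bar>Im s\<bar> \<ge> T \<and> \<bar>Im (Ln w)\<bar> \<le> \<bar>Im (Ln z)\<bar> \<and> \<bar>Re (Ln w)\<bar> \<le> L \<longrightarrow>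
           norm (mellin_kernel n lam w s) \<le> K * exp (- \<epsilon> * \<bar>Im s\<bar>)"
    using mellin_kernel_decay[OF assms(1) abs_Im_Ln_less[OF assms(2)], of lam] by blast
  show ?thesis
  proof (rule that[OF \<epsilon>(1)])
    fix a b
    obtain K T where "\<forall>s w. a \<le> Re s \<and> Re s \<le> b \<and> \<bar>Im s\<bar> \<ge> T \<and> \<bar>Im (Ln w)\<bar> \<le> \<bar>Im (Ln z)\<bar> \<and> \<bar>Re (Ln w)\<bar> \<le> \<bar>Re (Ln z)\<bar> \<longrightarrow>
           norm (mellin_kernel n lam w s) \<le> K * exp (- \<epsilon> * \<bar>Im s\<bar>)" using \<epsilon>(2)[of a b "\<bar>Re (Ln z)\<bar>"] by blast
    then have "\<forall>s. a \<le> Re s \<and> Re s \<le> b \<and> \<bar>Im s\<bar> \<ge> T \<longrightarrow> norm (mellin_kernel n lam z s) \<le> K * exp (- \<epsilon> * \<bar>Im s\<bar>)"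
      by simp
    then show "\<exists>(K::real) (T::real). \<forall>s. a \<le> Re s \<and> Re s \<le> b \<and> \<bar>Im s\<bar> \<ge> T \<longrightarrow> norm (mellin_kernel n lam z s) \<le> K * exp (- \<epsilon> * \<bar>Im s\<bar>)"
      by blast
  qed
qed

section \<open>Independence of the contour and holomorphy in z\<close>

lemma holomorphic_mellin_kernel: "mellin_kernel n lam z holomorphic_on - Gamma_poles n lam"
  unfolding mellin_kernel_def[abs_def] by (intro holomorphic_intros holomorphic_Gamma_prod)

lemma mellin_kernel_contour:
  assumes n: "n \<ge> 1" and z: "Re z > 0" and \<gamma>: "vertical_contour (Gamma_poles n lam) \<gamma>" and \<sigma>: "max_norm n lam + 1 \<le> \<sigma>"
  shows "integral UNIV (\<lambda>t. mellin_kernel n lam z (\<gamma> t) * vector_derivative \<gamma> (at t)) = 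
           \<i> * integral UNIV (\<lambda>t. mellin_kernel n lam z (Complex \<sigma> t))"
    and "(\<lambda>t. mellin_kernel n lam z (Complex \<sigma> t)) integrable_on UNIV"
proof -
  obtain \<epsilon> where \<epsilon>: "\<epsilon> > 0" "\<And>a b::real. \<exists>(K::real) (T::real). \<forall>s. a \<le> Re s \<and> Re s \<le> b \<and> \<bar>Im s\<bar> \<ge> T \<longrightarrow> norm (mellin_kernel n lam z s) \<le> K * exp (- \<epsilon> * \<bar>Im s\<bar>)"
    using mellin_kernel_decay_strip[OF n z, of lam] by blast
  note * = vertical_contour_integral_eq[OF holomorphic_mellin_kernel closed_Gamma_poles finite_Gamma_poles_right Re_Gamma_poles_less \<gamma> \<epsilon> \<sigma>]
  show "integral UNIV (\<lambda>t. mellin_kernel n lam z (\<gamma> t) * vector_derivative \<gamma> (at t)) = 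
           \<i> * integral UNIV (\<lambda>t. mellin_kernel n lam z (Complex \<sigma> t))" by (rule *(1))
  show "(\<lambda>t. mellin_kernel n lam z (Complex \<sigma> t)) integrable_on UNIV" by (rule *(2))
qed

lemma mellin_barnes_contour:
  assumes n: "n \<ge> 1" and z: "Re z > 0" and \<gamma>: "vertical_contour (Gamma_poles n lam) \<gamma>"
  shows "integral UNIV (\<lambda>t. mellin_kernel n lam z (\<gamma> t) * vector_derivative \<gamma> (at t)) = 2 * of_real pi * \<i> * mellin_barnes n lam z"
  unfolding mellin_barnes_def mellin_kernel_contour(1)[OF n z \<gamma> order_refl] by simp

lemma mellin_barnes_line:
  assumes n: "n \<ge> 1" and z: "Re z > 0" and \<sigma>: "max_norm n lam + 1 \<le> \<sigma>"
  shows "mellin_barnes n lam z = 1 / (2 * of_real pi) * integral UNIV (\<lambda>t. mellin_kernel n lam z (Complex \<sigma> t))"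
proof -
  have "vertical_contour (Gamma_poles n lam) (Complex (max_norm n lam + 1))"
    by (rule vertical_line_contour) (rule Re_Gamma_poles_less)
  from mellin_kernel_contour(1)[OF n z this \<sigma>] mellin_kernel_contour(1)[OF n z this order_refl]
  show ?thesis unfolding mellin_barnes_def by simp
qed

lemma continuous_Gamma_prod_line: 
  assumes "max_norm n lam + 1 \<le> \<sigma>"
  shows "continuous_on A (\<lambda>t. Gamma_prod n lam (Complex \<sigma> t))"
proof -
  have "continuous_on (- Gamma_poles n lam) (Gamma_prod n lam)"
    using holomorphic_Gamma_prod by (rule holomorphic_on_imp_continuous_on)
  moreover have "continuous_on A (Complex \<sigma>)" unfolding Complex_eq by (intro continuous_intros)
  ultimately show ?thesis
    by (rule continuous_on_compose2) (use Re_Gamma_poles_less[of _ n lam] assms in force)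
qed

text \<open>The integrals over [-N, N] are holomorphic by differentiation under the integral sign,
  and they converge uniformly on small closed discs.\<close>

lemma holomorphic_mellin_barnes:
  assumes n: "n \<ge> 1"
  shows "mellin_barnes n lam holomorphic_on {z. Re z > 0}"
proof -
  define \<sigma> where "\<sigma> = max_norm n lam + 1"
  define S where "S = {z. Re z > 0}"
  define g where "g z t = mellin_kernel n lam z (Complex \<sigma> t)" for z t
  have oS: "open S" unfolding S_def by (rule open_halfspace_Re_gt)
  have cS: "convex S" unfolding S_def by (rule convex_halfspace_Re_gt)
  have nz: "z \<notin> \<real>\<^sub>\<le>\<^sub>0" "z \<noteq> 0" if "z \<in> S" for z using that by (auto simp: S_def complex_nonpos_Reals_iff)
  have contG: "continuous_on A (\<lambda>t. Gamma_prod n lam (Complex \<sigma> t))" for A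
    by (rule continuous_Gamma_prod_line) (simp add: \<sigma>_def)
  have contC: "continuous_on A (Complex \<sigma>)" for A unfolding Complex_eq by (intro continuous_intros)
  have int: "g z integrable_on UNIV" if "z \<in> S" for z
    using mellin_kernel_contour(2)[OF n, of z lam "Complex \<sigma>" \<sigma>] vertical_line_contour[of "Gamma_poles n lam" \<sigma>] Re_Gamma_poles_less[of _ n lam] that
    by (auto simp: g_def[abs_def] \<sigma>_def S_def)
  have contg: "g z integrable_on {a..b}" for z a b
    unfolding g_def mellin_kernel_def
    by (intro integrable_continuous_interval continuous_intros contG contC)
  have hol: "(\<lambda>z. integral (cbox (- real N) (real N)) (g z)) holomorphic_on S" for N
  proof (rule leibniz_rule_holomorphic[OF _ _ _ cS])
    fix z t assume z: "z \<in> S"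
    show "((\<lambda>z. g z t) has_field_derivative Gamma_prod n lam (Complex \<sigma> t) * (exp (- of_nat n * Complex \<sigma> t * Ln z) * (- of_nat n * Complex \<sigma> t * inverse z))) (at z within S)"
      unfolding g_def mellin_kernel_def using nz[OF z]
      by (auto intro!: derivative_eq_intros simp: field_simps)
  next
    show "g z integrable_on cbox (- real N) (real N)" for z using contg by simp
  next
    have c2: "continuous_on (S \<times> cbox (- real N) (real N)) (\<lambda>p. Gamma_prod n lam (Complex \<sigma> (snd p)))"
      by (rule continuous_on_compose2[OF contG[of UNIV] continuous_on_snd[OF continuous_on_id]]) auto
    have c3: "continuous_on (S \<times> cbox (- real N) (real N)) (\<lambda>p. Complex \<sigma> (snd p))"
      by (rule continuous_on_compose2[OF contC[of UNIV] continuous_on_snd[OF continuous_on_id]]) auto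
    show "continuous_on (S \<times> cbox (- real N) (real N)) (\<lambda>(z, t). Gamma_prod n lam (Complex \<sigma> t) * (exp (- of_nat n * Complex \<sigma> t * Ln z) * (- of_nat n * Complex \<sigma> t * inverse z)))"
      unfolding case_prod_unfold using nz
      by (intro continuous_intros c2 c3) auto
  qed
  have "(\<lambda>z. integral UNIV (g z)) holomorphic_on S"
  proof (rule holomorphic_uniform_sequence[OF oS hol])
    fix z0 assume "z0 \<in> S"
    then obtain d where d: "d > 0" "cball z0 d \<subseteq> S" using oS open_contains_cball by blast
    have cont: "continuous_on (cball z0 d) Ln" using nz d by (intro continuous_intros) auto
    have ne: "cball z0 d \<noteq> {}" using d by auto
    \<comment> \<open>By compactness |Arg z| and |ln |z|| attain maxima on the disc, the former
      below pi/2. This gives one decay estimate for the whole disc.\<close>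
    obtain z1 where z1: "z1 \<in> cball z0 d" "\<And>z. z \<in> cball z0 d \<Longrightarrow> \<bar>Im (Ln z)\<bar> \<le> \<bar>Im (Ln z1)\<bar>"
      using continuous_attains_sup[OF compact_cball ne, of "\<lambda>z. \<bar>Im (Ln z)\<bar>"] continuous_on_rabs[OF continuous_on_Im[OF cont]] by blast
    obtain z2 where z2: "\<And>z. z \<in> cball z0 d \<Longrightarrow> \<bar>Re (Ln z)\<bar> \<le> \<bar>Re (Ln z2)\<bar>"
      using continuous_attains_sup[OF compact_cball ne, of "\<lambda>z. \<bar>Re (Ln z)\<bar>"] continuous_on_rabs[OF continuous_on_Re[OF cont]] by blast
    have "\<bar>Im (Ln z1)\<bar> < pi / 2" using z1 d by (intro abs_Im_Ln_less) (auto simp: S_def)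
    from mellin_kernel_decay[OF n this, of lam] obtain \<epsilon> K T where \<epsilon>: "\<epsilon> > 0" and
      K: "\<And>s z. \<sigma> \<le> Re s \<Longrightarrow> Re s \<le> \<sigma> \<Longrightarrow> \<bar>Im s\<bar> \<ge> T \<Longrightarrow> \<bar>Im (Ln z)\<bar> \<le> \<bar>Im (Ln z1)\<bar> \<Longrightarrow> \<bar>Re (Ln z)\<bar> \<le> \<bar>Re (Ln z2)\<bar> \<Longrightarrow>
           norm (mellin_kernel n lam z s) \<le> K * exp (- \<epsilon> * \<bar>Im s\<bar>)" by metis
    \<comment> \<open>Half of the exponent is spent on smallness in N, the other half on
      integrability in t; the last factor is the integral of exp (- (\<epsilon> / 2) |t|).\<close>
    define D where "D N = \<bar>K\<bar> * exp (- (\<epsilon> / 2) * real N) * (2 / (\<epsilon> / 2))" for N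
    have bound: "norm (integral (cbox (- real N) (real N)) (g z) - integral UNIV (g z)) \<le> D N" if N: "real N \<ge> T" and z: "z \<in> cball z0 d" for N z
    proof -
      define h where "h t = g z t - (if t \<in> {- real N..real N} then g z t else 0)" for t
      have h: "(h has_integral (integral UNIV (g z) - integral {- real N..real N} (g z))) UNIV"
        unfolding h_def
      proof (intro has_integral_diff integrable_integral int)
        show "((\<lambda>t. if t \<in> {- real N..real N} then g z t else 0) has_integral integral {- real N..real N} (g z)) UNIV"
          unfolding has_integral_restrict_UNIV using contg by (rule integrable_integral)
      qed (use z d in auto)
      have e: "((\<lambda>t. \<bar>K\<bar> * exp (- (\<epsilon> / 2) * real N) * exp (- (\<epsilon> / 2) * \<bar>t - 0\<bar>)) has_integral D N) UNIV"
        unfolding D_def by (intro has_integral_mult_right has_integral_exp_abs_shift) (use \<epsilon> in auto)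
      have "norm (integral UNIV h) \<le> integral UNIV (\<lambda>t. \<bar>K\<bar> * exp (- (\<epsilon> / 2) * real N) * exp (- (\<epsilon> / 2) * \<bar>t - 0\<bar>))"
      proof (rule Henstock_Kurzweil_Integration.integral_norm_bound_integral)
        fix t
        show "norm (h t) \<le> \<bar>K\<bar> * exp (- (\<epsilon> / 2) * real N) * exp (- (\<epsilon> / 2) * \<bar>t - 0\<bar>)"
        proof (cases "t \<in> {- real N..real N}")
          case True
          then have "h t = 0" unfolding h_def by (simp only: if_True diff_self)
          then show ?thesis by simp
        next
          case False
          then have t: "\<bar>t\<bar> \<ge> real N" by auto
          have "norm (h t) = norm (g z t)" using False by (simp only: h_def if_False diff_0_right)
          also have "\<dots> \<le> K * exp (- \<epsilon> * \<bar>t\<bar>)"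
            using K[of "Complex \<sigma> t" z] t N z1(2)[OF z] z2[OF z] by (simp add: g_def)
          also have "\<dots> \<le> \<bar>K\<bar> * exp (- \<epsilon> * \<bar>t\<bar>)" by (intro mult_right_mono) auto
          also have "- \<epsilon> * \<bar>t\<bar> \<le> - (\<epsilon> / 2) * real N + - (\<epsilon> / 2) * \<bar>t\<bar>"
            using mult_left_mono[OF t, of "\<epsilon> / 2"] \<epsilon> by (simp add: field_simps)
          then have "\<bar>K\<bar> * exp (- \<epsilon> * \<bar>t\<bar>) \<le> \<bar>K\<bar> * exp (- (\<epsilon> / 2) * real N + - (\<epsilon> / 2) * \<bar>t\<bar>)" by (intro mult_left_mono) auto
          also have "\<dots> = \<bar>K\<bar> * exp (- (\<epsilon> / 2) * real N) * exp (- (\<epsilon> / 2) * \<bar>t - 0\<bar>)" unfolding exp_add by simp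
          finally show ?thesis .
        qed
      qed (use h e in \<open>auto simp: integrable_on_def\<close>)
      then show ?thesis unfolding integral_unique[OF h] integral_unique[OF e] by (simp add: norm_minus_commute)
    qed
    have D0: "D \<longlonglongrightarrow> 0"
    proof -
      have "filterlim (\<lambda>N. - (\<epsilon> / 2) * real N) at_bot sequentially"
        using filterlim_tendsto_pos_mult_at_top[OF tendsto_const[of "\<epsilon> / 2"] _ filterlim_real_sequentially] \<epsilon>
        by (simp add: filterlim_uminus_at_bot)
      then have "(\<lambda>N. exp (- (\<epsilon> / 2) * real N)) \<longlonglongrightarrow> 0" by (rule filterlim_compose[OF exp_at_bot])
      then have "D \<longlonglongrightarrow> \<bar>K\<bar> * 0 * (2 / (\<epsilon> / 2))" unfolding D_def by (intro tendsto_intros)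
      then show ?thesis by simp
    qed
    have "uniform_limit (cball z0 d) (\<lambda>N z. integral (cbox (- real N) (real N)) (g z)) (\<lambda>z. integral UNIV (g z)) sequentially"
    proof (rule uniform_limitI)
      fix r :: real assume "r > 0"
      have "\<forall>\<^sub>F N in sequentially. D N < r" using D0 \<open>r > 0\<close> by (rule order_tendstoD(2))
      moreover have "\<forall>\<^sub>F N in sequentially. T \<le> real N" 
        using filterlim_real_sequentially by (simp add: filterlim_at_top)
      ultimately show "\<forall>\<^sub>F N in sequentially. \<forall>z\<in>cball z0 d. dist (integral (cbox (- real N) (real N)) (g z)) (integral UNIV (g z)) < r"
      proof eventually_elim
        case (elim N)
        show ?case
        proof
          fix z assume z: "z \<in> cball z0 d"
          show "dist (integral (cbox (- real N) (real N)) (g z)) (integral UNIV (g z)) < r"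
            using bound[OF elim(2) z] elim(1) unfolding dist_norm by linarith
        qed
      qed
    qed
    then show "\<exists>d>0. cball z0 d \<subseteq> S \<and> uniform_limit (cball z0 d) (\<lambda>N z. integral (cbox (- real N) (real N)) (g z)) (\<lambda>z. integral UNIV (g z)) sequentially"
      using d by blast
  qed
  then show ?thesis
    unfolding mellin_barnes_def[abs_def] g_def[abs_def] \<sigma>_def S_def by (intro holomorphic_intros)
qed

text \<open>Second-order Taylor estimate for - ln cos at \<theta>, whose derivatives are tan and 1 /
  cos^2. Taylor's factor 1/2 is missing because the mean value inequality is applied twice.\<close>

lemma ln_cos_diff_le:
  assumes "\<bar>\<theta>\<bar> \<le> \<theta>1" "\<bar>\<phi>\<bar> \<le> \<theta>1" "\<theta>1 < pi / 2"
  shows "ln (cos \<theta>) - ln (cos \<phi>) \<le> tan \<theta> * (\<phi> - \<theta>) + (\<phi> - \<theta>)\<^sup>2 / (cos \<theta>1)\<^sup>2"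
proof -
  have cp: "cos x \<ge> cos \<theta>1" "cos x > 0" if "\<bar>x\<bar> \<le> \<theta>1" for x
  proof -
    have "cos \<bar>x\<bar> \<ge> cos \<theta>1" using that assms pi_gt_zero by (intro cos_monotone_0_pi_le) auto
    then show "cos x \<ge> cos \<theta>1" by simp
    show "cos x > 0" using that assms by (intro cos_gt_zero_pi) auto
  qed
  have c1: "cos \<theta>1 > 0" using assms by (intro cos_gt_zero_pi) auto
  have lip: "\<bar>tan x - tan \<theta>\<bar> \<le> \<bar>x - \<theta>\<bar> / (cos \<theta>1)\<^sup>2" if "\<bar>x\<bar> \<le> \<theta>1" for x
  proof -
    have "norm (tan x - tan \<theta>) \<le> (1 / (cos \<theta>1)\<^sup>2) * norm (x - \<theta>)"
    proof (rule field_differentiable_bound[where S = "{-\<theta>1..\<theta>1}" and f' = "\<lambda>x. inverse ((cos x)\<^sup>2)"])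
      fix y assume y: "y \<in> {-\<theta>1..\<theta>1}"
      then have "\<bar>y\<bar> \<le> \<theta>1" by auto
      note cy = cp[OF this]
      show "(tan has_field_derivative inverse ((cos y)\<^sup>2)) (at y within {-\<theta>1..\<theta>1})"
        using cy by (intro DERIV_subset[OF DERIV_tan]) auto
      show "norm (inverse ((cos y)\<^sup>2)) \<le> 1 / (cos \<theta>1)\<^sup>2"
        using power_mono[OF cy(1), of 2] c1 cy by (auto simp: inverse_eq_divide intro!: divide_left_mono)
    qed (use that assms in auto)
    then show ?thesis by simp
  qed
  show ?thesis
  proof (cases "\<phi> = \<theta>")
    case False
    have der: "((\<lambda>x. - ln (cos x)) has_real_derivative tan x) (at x)" if "\<bar>x\<bar> \<le> \<theta>1" for x
      using DERIV_minus[OF ln_cos_deriv[OF cp(2)[OF that]]] by simp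
    obtain \<xi> where \<xi>: "\<bar>\<xi> - \<theta>\<bar> \<le> \<bar>\<phi> - \<theta>\<bar>" "\<bar>\<xi>\<bar> \<le> \<theta>1" "ln (cos \<theta>) - ln (cos \<phi>) = (\<phi> - \<theta>) * tan \<xi>"
    proof (cases "\<theta> < \<phi>")
      case True
      obtain z where "\<theta> < z" "z < \<phi>" "- ln (cos \<phi>) - - ln (cos \<theta>) = (\<phi> - \<theta>) * tan z"
        using MVT2[OF True, of "\<lambda>x. - ln (cos x)" tan] der assms by force
      then show ?thesis using that[of z] assms by auto
    next
      case f: False
      then have lt: "\<phi> < \<theta>" using False by auto
      obtain z where "\<phi> < z" "z < \<theta>" "- ln (cos \<theta>) - - ln (cos \<phi>) = (\<theta> - \<phi>) * tan z"
        using MVT2[OF lt, of "\<lambda>x. - ln (cos x)" tan] der assms by force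
      then show ?thesis using that[of z] assms by (auto simp: algebra_simps)
    qed
    have "(\<phi> - \<theta>) * (tan \<xi> - tan \<theta>) \<le> \<bar>\<phi> - \<theta>\<bar> * \<bar>tan \<xi> - tan \<theta>\<bar>" by (metis abs_ge_self abs_mult)
    also have "\<dots> \<le> \<bar>\<phi> - \<theta>\<bar> * (\<bar>\<phi> - \<theta>\<bar> / (cos \<theta>1)\<^sup>2)"
      using order_trans[OF lip[OF \<xi>(2)] divide_right_mono[OF \<xi>(1)]] by (intro mult_left_mono) auto
    also have "\<dots> = (\<phi> - \<theta>)\<^sup>2 / (cos \<theta>1)\<^sup>2" by (simp add: power2_eq_square)
    finally show ?thesis unfolding \<xi>(3) by (simp add: algebra_simps)
  qed simp
qed

text \<open>The line \<open>Re s = Re z\<close> passes through the saddle point \<open>s = z\<close> of \<open>\<Gamma>(s)\<^sup>n z\<^bsup>-ns\<^esup>\<close>. Rotating the angle in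
  \<open>norm_prod_Gamma_le\<close> away from \<open>Arg z\<close> by \<open>\<kappa> / sqrt (Re z)\<close>, on the side depending on the sign of
  \<open>t - Im z\<close>, gives exponential decay of width \<open>sqrt (Re z)\<close> around the saddle point.\<close>

lemma mellin_barnes_bound:
  assumes n: "n \<ge> 1" and \<theta>0: "0 \<le> \<theta>0" "\<theta>0 < pi / 2"
  shows "\<exists>K>0. \<forall>lam z. (\<Sum>l=1..n. lam l) = 0 \<and> Re z \<ge> 5 * (max_norm n lam + 1)\<^sup>2 \<and> \<bar>Im (Ln z)\<bar> \<le> \<theta>0 \<longrightarrow>
     norm (mellin_barnes n lam z) \<le> K * Re z powr (- ((real n - 1) / 2)) * exp (- real n * Re z)"
proof -
  obtain K0 where K0: "K0 > 0" "\<And>x::real. x \<ge> 1 \<Longrightarrow> Gamma x \<le> K0 * x powr (x - 1/2) * exp (- x)" using Gamma_le_Stirling by blast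
  \<comment> \<open>Half of the gap between \<theta>0 and pi/2, so that angles rotated by at most
    \<kappa> stay within \<theta>1 < pi/2.\<close>
  define \<kappa> where "\<kappa> = (pi / 2 - \<theta>0) / 2"
  define \<theta>1 where "\<theta>1 = \<theta>0 + \<kappa>"
  have \<kappa>: "\<kappa> > 0" "\<theta>1 < pi / 2" "0 < \<theta>1" using \<theta>0 by (auto simp: \<kappa>_def \<theta>1_def field_simps)
  define A where "A = \<kappa>\<^sup>2 / (cos \<theta>1)\<^sup>2"
  define K1 where "K1 = exp (4 * real n) * (K0 ^ n * exp (real n * A))"
  define K where "K = 1 / (2 * pi) * (K1 * (2 / (n * \<kappa>)))"
  have "K > 0" using K0 \<kappa> n by (auto simp: K_def K1_def intro!: mult_pos_pos)
  moreover have "norm (mellin_barnes n lam z) \<le> K * Re z powr (- ((real n - 1) / 2)) * exp (- real n * Re z)"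
    if sum0: "(\<Sum>l=1..n. lam l) = 0" and z: "Re z \<ge> 5 * (max_norm n lam + 1)\<^sup>2" and arg: "\<bar>Im (Ln z)\<bar> \<le> \<theta>0" for lam z
  proof -
    define C where "C = max_norm n lam + 1"
    define \<sigma> where "\<sigma> = Re z"
    define \<theta> where "\<theta> = Im (Ln z)"
    have C: "C \<ge> 1" using max_norm_nonneg[OF n] by (simp add: C_def)
    have "C * 1 \<le> C * C" using C by (intro mult_left_mono) auto
    then have C2: "C \<le> C\<^sup>2" by (simp add: power2_eq_square)
    have \<sigma>C: "5 * C\<^sup>2 \<le> \<sigma>" using z by (simp add: \<sigma>_def C_def)
    then have \<sigma>: "\<sigma> \<ge> 1" "5 * C \<le> \<sigma>" "C \<le> \<sigma>" using C C2 by linarith+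
    have Rz: "Re z > 0" using \<sigma> by (simp add: \<sigma>_def)
    then have z0: "z \<noteq> 0" by auto
    have zexp: "z = exp (Ln z)" using z0 by simp
    have Rez: "\<sigma> = exp (Re (Ln z)) * cos \<theta>" unfolding \<sigma>_def \<theta>_def by (subst zexp) (simp only: Re_exp)
    have Imz: "Im z = exp (Re (Ln z)) * sin \<theta>" unfolding \<theta>_def by (subst zexp) (simp only: Im_exp)
    have cos: "cos \<theta> > 0" using arg \<theta>0 by (intro cos_gt_zero_pi) (auto simp: \<theta>_def)
    have lnz: "Re (Ln z) = ln \<sigma> - ln (cos \<theta>)" unfolding Rez using cos by (simp add: ln_mult)
    \<comment> \<open>The saddle point condition: the first-order cost \<sigma> tan \<theta> (\<phi>
      - \<theta>) of a rotation equals (\<phi> - \<theta>) Im z, so that all linear terms combine to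
      - (\<phi> - \<theta>) (t - Im z).\<close>
    have t0: "Im z = \<sigma> * tan \<theta>" using Rez Imz cos by (simp add: tan_def)
    \<comment> \<open>The largest order of rotation whose second-order cost, at most \<sigma> d^2 /
      cos^2 \<theta>1 = \<open>A\<close>, stays bounded.\<close>
    define d where "d = \<kappa> / sqrt \<sigma>"
    have d: "d > 0" "d \<le> \<kappa>" "\<sigma> * d\<^sup>2 = \<kappa>\<^sup>2" using \<sigma> \<kappa> by (auto simp: d_def power_divide divide_le_eq)
    have pt: "norm (mellin_kernel n lam z (Complex \<sigma> t)) \<le> K1 * (\<sigma> powr (- (real n / 2)) * exp (- real n * \<sigma>)) * exp (- (n * d) * \<bar>t - Im z\<bar>)" for t
    proof -
      define \<phi> where "\<phi> = \<theta> + d * sgn (t - Im z)"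
      have \<phi>1: "\<bar>\<phi>\<bar> \<le> \<theta>1" "\<bar>\<theta>\<bar> \<le> \<theta>1" using arg d \<kappa> unfolding \<phi>_def \<theta>1_def \<theta>_def by (auto simp: sgn_if)
      then have \<phi>2: "\<bar>\<phi>\<bar> < pi / 2" using \<kappa> by linarith
      have dsq: "(\<phi> - \<theta>)\<^sup>2 \<le> d\<^sup>2" by (auto simp: \<phi>_def sgn_if)
      have dt: "(\<phi> - \<theta>) * (t - Im z) = d * \<bar>t - Im z\<bar>" by (auto simp: \<phi>_def sgn_if abs_if)
      have "norm (Gamma_prod n lam (Complex \<sigma> t)) \<le> exp (18 * n * C\<^sup>2 / \<sigma>) * (Gamma \<sigma> * exp (- \<phi> * t - \<sigma> * ln (cos \<phi>))) ^ n"
        using norm_prod_Gamma_le[OF finite_atLeastAtMost sum0, where C=C and \<sigma>=\<sigma> and \<phi>=\<phi> and t=t] max_norm_ge[of _ n lam] \<sigma> \<phi>2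
        by (force simp: Gamma_prod_def C_def)
      also have "\<dots> \<le> exp (4 * real n) * (K0 * \<sigma> powr (\<sigma> - 1/2) * exp (- \<sigma>) * exp (- \<phi> * t - \<sigma> * ln (cos \<phi>))) ^ n"
      proof (intro mult_mono power_mono)
        \<comment> \<open>Here the shifts are absorbed: \<sigma> \<ge> 5 C^2 makes their
          second-order factor at most exp (4 n), as 18 \<le> 4 * 5.\<close>
        have "18 * n * C\<^sup>2 \<le> (4 * n) * (5 * C\<^sup>2)" by (simp add: algebra_simps)
        also have "\<dots> \<le> (4 * n) * \<sigma>" by (intro mult_left_mono \<sigma>C) auto
        finally show "exp (18 * n * C\<^sup>2 / \<sigma>) \<le> exp (4 * real n)" using \<sigma> by (simp add: divide_le_eq)
        show "Gamma \<sigma> \<le> K0 * \<sigma> powr (\<sigma> - 1/2) * exp (- \<sigma>)" by (rule K0(2)[OF \<sigma>(1)])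
      qed (use \<sigma> K0(1) Gamma_real_pos[of \<sigma>] in \<open>auto intro!: mult_nonneg_nonneg\<close>)
      also have "\<dots> = exp (4 * real n) * (K0 ^ n * exp (n * ((\<sigma> - 1/2) * ln \<sigma> - \<sigma> - \<phi> * t - \<sigma> * ln (cos \<phi>))))"
      proof -
        have "\<sigma> powr (\<sigma> - 1/2) * exp (- \<sigma>) * exp (- \<phi> * t - \<sigma> * ln (cos \<phi>)) = exp ((\<sigma> - 1/2) * ln \<sigma> - \<sigma> - \<phi> * t - \<sigma> * ln (cos \<phi>))"
          using \<sigma> by (simp add: powr_def mult_exp_exp algebra_simps)
        then show ?thesis by (simp add: power_mult_distrib mult.assoc exp_of_nat_mult)
      qed
      finally have "norm (mellin_kernel n lam z (Complex \<sigma> t)) \<le> 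
          exp (4 * real n) * (K0 ^ n * exp (n * ((\<sigma> - 1/2) * ln \<sigma> - \<sigma> - \<phi> * t - \<sigma> * ln (cos \<phi>)))) * exp (n * (t * \<theta> - \<sigma> * (ln \<sigma> - ln (cos \<theta>))))"
        unfolding mellin_kernel_def norm_mult norm_exp_Ln by (simp add: \<theta>_def[symmetric] lnz)
      also have "\<dots> = exp (4 * real n) * (K0 ^ n * exp (n * (- (1/2) * ln \<sigma> - \<sigma> - (\<phi> - \<theta>) * t + \<sigma> * (ln (cos \<theta>) - ln (cos \<phi>)))))"
        by (simp add: mult_exp_exp algebra_simps)
      also have "\<dots> \<le> exp (4 * real n) * (K0 ^ n * exp (n * (- (1/2) * ln \<sigma> - \<sigma> - d * \<bar>t - Im z\<bar> + A)))"
      proof -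
        have "\<sigma> * (ln (cos \<theta>) - ln (cos \<phi>)) \<le> \<sigma> * (tan \<theta> * (\<phi> - \<theta>) + (\<phi> - \<theta>)\<^sup>2 / (cos \<theta>1)\<^sup>2)"
          using \<sigma> by (intro mult_left_mono ln_cos_diff_le \<phi>1 \<kappa>) auto
        also have "\<dots> = (\<phi> - \<theta>) * Im z + \<sigma> * (\<phi> - \<theta>)\<^sup>2 / (cos \<theta>1)\<^sup>2" by (simp add: t0 algebra_simps)
        also have "\<sigma> * (\<phi> - \<theta>)\<^sup>2 / (cos \<theta>1)\<^sup>2 \<le> \<sigma> * d\<^sup>2 / (cos \<theta>1)\<^sup>2"
          using dsq \<sigma> by (intro divide_right_mono mult_left_mono) auto
        finally have "\<sigma> * (ln (cos \<theta>) - ln (cos \<phi>)) \<le> (\<phi> - \<theta>) * Im z + A" by (simp add: d(3) A_def)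
        then have "- (\<phi> - \<theta>) * t + \<sigma> * (ln (cos \<theta>) - ln (cos \<phi>)) \<le> - (d * \<bar>t - Im z\<bar>) + A"
          using dt by (simp add: algebra_simps)
        then have "- (1/2) * ln \<sigma> - \<sigma> - (\<phi> - \<theta>) * t + \<sigma> * (ln (cos \<theta>) - ln (cos \<phi>)) \<le> - (1/2) * ln \<sigma> - \<sigma> - d * \<bar>t - Im z\<bar> + A"
          by linarith
        then show ?thesis using K0(1) by (intro mult_left_mono iffD2[OF exp_le_cancel_iff]) auto
      qed
      also have "\<dots> = K1 * (\<sigma> powr (- (real n / 2)) * exp (- real n * \<sigma>)) * exp (- (n * d) * \<bar>t - Im z\<bar>)"
        using \<sigma> by (simp add: K1_def powr_def mult_exp_exp algebra_simps)
      finally show ?thesis .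
    qed
    define R where "R = K1 * (\<sigma> powr (- (real n / 2)) * exp (- real n * \<sigma>))"
    have hi: "((\<lambda>t. R * exp (- (n * d) * \<bar>t - Im z\<bar>)) has_integral R * (2 / (n * d))) UNIV"
      using d n by (intro has_integral_mult_right has_integral_exp_abs_shift) auto
    have "norm (integral UNIV (\<lambda>t. mellin_kernel n lam z (Complex \<sigma> t))) \<le> integral UNIV (\<lambda>t. R * exp (- (n * d) * \<bar>t - Im z\<bar>))"
    proof (rule Henstock_Kurzweil_Integration.integral_norm_bound_integral)
      show "(\<lambda>t. mellin_kernel n lam z (Complex \<sigma> t)) integrable_on UNIV"
        by (rule mellin_kernel_contour(2)[OF n Rz vertical_line_contour[of _ \<sigma>]])
           (use Re_Gamma_poles_less[of _ n lam] \<sigma>(3) in \<open>force simp: C_def\<close>)+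
    qed (use hi pt in \<open>auto simp: integrable_on_def R_def\<close>)
    also have "\<dots> = R * (2 / (n * d))" using hi by (rule integral_unique)
    finally have le: "norm (integral UNIV (\<lambda>t. mellin_kernel n lam z (Complex \<sigma> t))) \<le> R * (2 / (n * d))" .
    have "norm (mellin_barnes n lam z) = 1 / (2 * pi) * norm (integral UNIV (\<lambda>t. mellin_kernel n lam z (Complex \<sigma> t)))"
      using mellin_barnes_line[OF n Rz, of lam \<sigma>] \<sigma>(3) by (simp add: C_def norm_divide)
    also have "\<dots> \<le> 1 / (2 * pi) * (R * (2 / (n * d)))" by (intro mult_left_mono le) auto
    also have "\<dots> = K * (\<sigma> powr (- (real n / 2)) * sqrt \<sigma>) * exp (- real n * \<sigma>)"
      using \<sigma> \<kappa> n by (simp add: R_def K_def d_def field_simps)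
    \<comment> \<open>The factor sqrt \<sigma> is the width 1 / d of the saddle and turns the
      exponent n / 2 into (n - 1) / 2.\<close>
    also have "\<sigma> powr (- (real n / 2)) * sqrt \<sigma> = \<sigma> powr (- ((real n - 1) / 2))"
      using \<sigma> by (simp add: powr_half_sqrt[symmetric] powr_add[symmetric] diff_divide_distrib)
    finally show ?thesis by (simp add: \<sigma>_def)
  qed
  ultimately show ?thesis by blast
qed

section \<open>Bessel functions\<close>

text \<open>A derivative at x > 0 sees the function only near x, so the identity on the open
  half-line can be differentiated repeatedly; each step brings out one factor \<omega>.\<close>

lemma nth_derivative_ray:
  fixes f :: "real \<Rightarrow> complex"
  assumes hol: "g holomorphic_on {z. Re z > 0}" and \<omega>: "Re \<omega> > 0"
    and eq: "\<And>x. x > 0 \<Longrightarrow> f x = c * g (\<omega> * of_real x)" and "x > 0"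
  shows "nth_derivative j f x = c * \<omega> ^ j * (deriv ^^ j) g (\<omega> * of_real x)"
  using \<open>x > 0\<close>
proof (induction j arbitrary: x)
  case 0
  then show ?case by (simp add: nth_derivative_def eq)
next
  case (Suc j)
  have S: "open {z. Re z > 0}" by (rule open_halfspace_Re_gt)
  have "(deriv ^^ j) g holomorphic_on {z. Re z > 0}" by (rule holomorphic_higher_deriv[OF hol S])
  then have "((deriv ^^ j) g has_field_derivative deriv ((deriv ^^ j) g) (\<omega> * of_real x)) (at (\<omega> * of_real x))"
    by (rule holomorphic_derivI[OF _ S]) (use \<omega> Suc.prems in simp)
  then have "((\<lambda>x. (deriv ^^ j) g (\<omega> * of_real x)) has_vector_derivative (\<omega> * (deriv ^^ Suc j) g (\<omega> * of_real x))) (at x)"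
    by (intro field_vector_diff_chain_at[where f="\<lambda>x. \<omega> * of_real x" and g="(deriv ^^ j) g", unfolded o_def])
       (auto intro!: derivative_eq_intros)
  then have "((\<lambda>x. c * \<omega> ^ j * (deriv ^^ j) g (\<omega> * of_real x)) has_vector_derivative c * \<omega> ^ Suc j * (deriv ^^ Suc j) g (\<omega> * of_real x)) (at x)"
    by (auto intro!: derivative_eq_intros)
  then have "(nth_derivative j f has_vector_derivative c * \<omega> ^ Suc j * (deriv ^^ Suc j) g (\<omega> * of_real x)) (at x)"
    by (rule has_vector_derivative_transform_within_open[of _ _ _ "{0<..}"]) (use Suc in auto)
  then show ?case by (simp add: nth_derivative_def vector_derivative_at)
qed

lemma bessel_contour_vertical: "bessel_contour n lam \<gamma> \<Longrightarrow> vertical_contour (Gamma_poles n lam) \<gamma>"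
  unfolding bessel_contour_def vertical_contour_def Gamma_poles_def by blast

section \<open>Splitting by signs and the phase factors\<close>

lemma sign_set_split:
  assumes "\<forall>l\<in>{1..n}. sg l = 1 \<or> sg l = -1"
  shows "{1..n} = sign_set n 1 sg \<union> sign_set n (-1) sg" "sign_set n 1 sg \<inter> sign_set n (-1) sg = {}"
  using assms by (auto simp: sign_set_def)

lemma finite_sign_set [simp]: "finite (sign_set n s sg)" by (simp add: sign_set_def)

lemma card_sign_set_add:
  assumes "\<forall>l\<in>{1..n}. sg l = 1 \<or> sg l = -1"
  shows "card (sign_set n 1 sg) + card (sign_set n (-1) sg) = n"
  using card_Un_disjoint[of "sign_set n 1 sg" "sign_set n (-1) sg"] sign_set_split[OF assms] 
  by (metis card_atLeastAtMost diff_Suc_1 finite_sign_set)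

lemma sum_sign_set:
  fixes h :: "nat \<Rightarrow> 'a::comm_ring_1"
  assumes "\<forall>l\<in>{1..n}. sg l = 1 \<or> sg l = -1"
  shows "(\<Sum>l=1..n. of_int (sg l) * h l) = (\<Sum>l\<in>sign_set n 1 sg. h l) - (\<Sum>l\<in>sign_set n (-1) sg. h l)"
    and "(\<Sum>l=1..n. h l) = (\<Sum>l\<in>sign_set n 1 sg. h l) + (\<Sum>l\<in>sign_set n (-1) sg. h l)"
proof -
  show "(\<Sum>l=1..n. h l) = (\<Sum>l\<in>sign_set n 1 sg. h l) + (\<Sum>l\<in>sign_set n (-1) sg. h l)" for h :: "nat \<Rightarrow> 'a"
    using sum.union_disjoint[of "sign_set n 1 sg" "sign_set n (-1) sg" h] sign_set_split[OF assms] by simp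
  then have "(\<Sum>l=1..n. of_int (sg l) * h l) = (\<Sum>l\<in>sign_set n 1 sg. of_int (sg l) * h l) + (\<Sum>l\<in>sign_set n (-1) sg. of_int (sg l) * h l)" .
  also have "(\<Sum>l\<in>sign_set n 1 sg. of_int (sg l) * h l) = (\<Sum>l\<in>sign_set n 1 sg. h l)"
    by (intro sum.cong) (auto simp: sign_set_def)
  also have "(\<Sum>l\<in>sign_set n (-1) sg. of_int (sg l) * h l) = (\<Sum>l\<in>sign_set n (-1) sg. - h l)"
    by (intro sum.cong) (auto simp: sign_set_def)
  finally show "(\<Sum>l=1..n. of_int (sg l) * h l) = (\<Sum>l\<in>sign_set n 1 sg. h l) - (\<Sum>l\<in>sign_set n (-1) sg. h l)"
    by (simp add: sum_negf)
qed

text \<open>With p plus signs and \<Sigma> the sum of \<open>lam\<close> over them, the phases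
  multiply to exp (i pi (2p - n) s / 2 - i pi \<Sigma>), the minus signs contributing a second
  \<Sigma> because the total is 0. As n \<theta> = pi (n - 2p) / 2, the part with s rotates x to x
  exp (i \<theta>), and - \<Sigma> is \<Lambda>.\<close>

lemma bessel_J_eq_mellin_barnes:
  assumes n: "n \<ge> 1" and sg: "\<forall>l\<in>{1..n}. sg l = 1 \<or> sg l = -1" and sum0: "(\<Sum>l=1..n. lam l) = 0"
    and \<theta>: "\<theta> = pi / 2 - pi * card (sign_set n 1 sg) / n" "\<bar>\<theta>\<bar> < pi / 2"
    and \<gamma>: "bessel_contour n lam \<gamma>" and x: "x > 0"
  shows "bessel_J n sg lam \<gamma> x = exp (\<i> * of_real pi * Lambda_sum 1 n sg lam) * mellin_barnes n lam (cis \<theta> * of_real x)"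
proof -
  define p where "p = card (sign_set n 1 sg)"
  define \<Sigma> where "\<Sigma> = (\<Sum>l\<in>sign_set n 1 sg. lam l)"
  have Sm: "(\<Sum>l\<in>sign_set n (-1) sg. lam l) = - \<Sigma>"
    using sum_sign_set(2)[OF sg, of lam] sum0 by (simp add: \<Sigma>_def eq_neg_iff_add_eq_0 add.commute)
  have Re: "Re (cis \<theta> * of_real x) > 0" using x cos_gt_zero_pi[of \<theta>] \<theta>(2) by (simp add: abs_less_iff)
  have Ln: "Ln (cis \<theta> * of_real x) = ln x + \<i> * \<theta>"
  proof (rule Ln_unique)
    show "exp (complex_of_real (ln x) + \<i> * complex_of_real \<theta>) = cis \<theta> * of_real x"
      using x by (simp add: exp_add cis_conv_exp exp_of_real)
  qed (use \<theta>(2) in auto)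
  have kernel: "(\<Prod>l=1..n. Gamma (s - lam l) * e (of_int (sg l) * (s - lam l) / 4)) * complex_of_real x powr (- of_nat n * s)
     = exp (\<i> * of_real pi * Lambda_sum 1 n sg lam) * mellin_kernel n lam (cis \<theta> * of_real x) s" for s
  proof -
    have "(\<Prod>l=1..n. e (of_int (sg l) * (s - lam l) / 4)) = exp (\<Sum>l=1..n. of_int (sg l) * ((\<i> * pi / 2) * (s - lam l)))"
    proof -
      have "e (of_int (sg l) * (s - lam l) / 4) = exp (of_int (sg l) * ((\<i> * pi / 2) * (s - lam l)))" for l
        unfolding e_def by (rule arg_cong[of _ _ exp]) (simp add: field_simps)
      then show ?thesis by (simp only: exp_sum[OF finite_atLeastAtMost])
    qed
    also have "(\<Sum>l=1..n. of_int (sg l) * ((\<i> * pi / 2) * (s - lam l))) = 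
        (\<i> * pi / 2) * (\<Sum>l\<in>sign_set n 1 sg. s - lam l) - (\<i> * pi / 2) * (\<Sum>l\<in>sign_set n (-1) sg. s - lam l)"
      unfolding sum_sign_set(1)[OF sg] by (simp only: sum_distrib_left)
    also have "(\<Sum>l\<in>sign_set n 1 sg. s - lam l) = of_nat p * s - \<Sigma>"
      by (simp add: sum_subtractf p_def \<Sigma>_def)
    also have "(\<Sum>l\<in>sign_set n (-1) sg. s - lam l) = (of_nat n - of_nat p) * s + \<Sigma>"
    proof -
      have "of_nat p + of_nat (card (sign_set n (-1) sg)) = (of_nat n :: complex)"
        using card_sign_set_add[OF sg] unfolding p_def by (metis of_nat_add)
      then have "of_nat (card (sign_set n (-1) sg)) = (of_nat n - of_nat p :: complex)" by (simp add: algebra_simps)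
      then show ?thesis by (simp add: sum_subtractf Sm)
    qed
    finally have pe: "(\<Prod>l=1..n. e (of_int (sg l) * (s - lam l) / 4)) = 
        exp ((\<i> * pi / 2) * (of_nat p * s - \<Sigma>) - (\<i> * pi / 2) * ((of_nat n - of_nat p) * s + \<Sigma>))" .
    have n\<theta>: "of_nat n * complex_of_real \<theta> = of_real pi / 2 * of_nat n - of_real pi * of_nat p"
    proof -
      have "real n * \<theta> = pi / 2 * n - pi * p" using n unfolding \<theta> p_def by (simp add: field_simps)
      then have "complex_of_real (real n * \<theta>) = complex_of_real (pi / 2 * n - pi * p)" by (rule arg_cong)
      then show ?thesis by simp
    qed
    have "complex_of_real x powr (- of_nat n * s) = exp (- of_nat n * s * ln x)"
      using x by (simp add: powr_def Ln_of_real)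
    then have "(\<Prod>l=1..n. Gamma (s - lam l) * e (of_int (sg l) * (s - lam l) / 4)) * complex_of_real x powr (- of_nat n * s)
       = Gamma_prod n lam s * exp ((\<i> * pi / 2) * (of_nat p * s - \<Sigma>) - (\<i> * pi / 2) * ((of_nat n - of_nat p) * s + \<Sigma>) + - of_nat n * s * ln x)"
      unfolding prod.distrib pe exp_add Gamma_prod_def by (simp only: mult.assoc)
    also have "(\<i> * pi / 2) * (of_nat p * s - \<Sigma>) - (\<i> * pi / 2) * ((of_nat n - of_nat p) * s + \<Sigma>) + - of_nat n * s * ln x
       = - \<i> * pi * \<Sigma> + (- of_nat n * s * ln x - \<i> * s * (of_real pi / 2 * of_nat n - of_real pi * of_nat p))"
      by (simp add: field_simps)
    also have "\<dots> = \<i> * of_real pi * Lambda_sum 1 n sg lam + - of_nat n * s * Ln (cis \<theta> * of_real x)"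
      unfolding n\<theta>[symmetric] Ln by (simp add: Lambda_sum_def \<Sigma>_def algebra_simps)
    finally show ?thesis unfolding exp_add mellin_kernel_def by (simp only: mult_ac)
  qed
  have "bessel_J n sg lam \<gamma> x = 1 / (2 * of_real pi * \<i>) * integral UNIV (\<lambda>t. exp (\<i> * of_real pi * Lambda_sum 1 n sg lam) *
      (mellin_kernel n lam (cis \<theta> * of_real x) (\<gamma> t) * vector_derivative \<gamma> (at t)))"
    unfolding bessel_J_def kernel by (simp only: mult.assoc)
  also have "\<dots> = 1 / (2 * of_real pi * \<i>) * (exp (\<i> * of_real pi * Lambda_sum 1 n sg lam) * (2 * of_real pi * \<i> * mellin_barnes n lam (cis \<theta> * of_real x)))"
    by (subst integral_mult_right) (simp only: mellin_barnes_contour[OF n Re bessel_contour_vertical[OF \<gamma>]])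
  also have "\<dots> = exp (\<i> * of_real pi * Lambda_sum 1 n sg lam) * mellin_barnes n lam (cis \<theta> * of_real x)"
    by (simp add: field_simps)
  finally show ?thesis .
qed

text \<open>The sine increases in k up to n / 2 and is symmetric under k \<mapsto> n - k. For m = 1
  this makes sin (pi / n) the least value of I; m = 2 serves when both signs occur at least
  twice.\<close>

lemma sin_pi_frac_ge:
  assumes "m \<le> k" "k + m \<le> n" "n \<ge> 1"
  shows "sin (real m / real n * pi) \<le> sin (real k / real n * pi)"
proof -
  have *: "sin (real m / real n * pi) \<le> sin (real k / real n * pi)" if "m \<le> k" "2 * k \<le> n" for k
  proof (rule sin_monotone_2pi_le)
    have "real k / real n \<le> 1 / 2" using that assms(3) by (simp add: field_simps)
    then show "real k / real n * pi \<le> pi / 2" by (metis mult_right_mono pi_ge_zero times_divide_eq_left mult_1)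
    show "real m / real n * pi \<le> real k / real n * pi" using that assms(3) by (intro mult_right_mono divide_right_mono) auto
    show "- (pi / 2) \<le> real m / real n * pi" using pi_ge_zero by (smt (verit) divide_nonneg_nonneg mult_nonneg_nonneg of_nat_0_le_iff)
  qed
  show ?thesis
  proof (cases "2 * k \<le> n")
    case True then show ?thesis using * assms by simp
  next
    case False
    have "real (n - k) / real n * pi = pi - real k / real n * pi"
      using assms by (simp add: of_nat_diff field_simps)
    then have "sin (real (n - k) / real n * pi) = sin (real k / real n * pi)" by (simp only: sin_pi_minus)
    moreover have "sin (real m / real n * pi) \<le> sin (real (n - k) / real n * pi)" using False assms by (intro *) auto
    ultimately show ?thesis by simp
  qed
qed

lemma sin_pi_frac_pos:
  assumes "0 < k" "k < n" shows "sin (real k / real n * pi) > 0"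
proof (rule sin_gt_zero)
  show "0 < real k / real n * pi" using assms by simp
  have "real k / real n < 1" using assms by simp
  then have "real k / real n * pi < 1 * pi" by (intro mult_strict_right_mono) auto
  then show "real k / real n * pi < pi" by simp
qed

text \<open>Within 1/2 of x exp (i \<theta>) the real part is at least x sin (pi / n) / 2, which
  turns the constant 10 into the 5 of \<open>mellin_barnes_bound\<close>. The argument is bounded
  uniformly as well, so Cauchy's inequality loses a factor depending only on n and j.\<close>

lemma mellin_barnes_deriv_bound:
  assumes n: "n \<ge> 2" 
  shows "\<exists>K>0::real. \<forall>lam x \<theta>. (\<Sum>l=1..n. lam l) = 0 \<and> x * sin (pi / n) \<ge> 10 * (max_norm n lam + 1)\<^sup>2 \<and> \<bar>\<theta>\<bar> < pi / 2 \<and> sin (pi / n) \<le> cos \<theta> \<longrightarrow>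
     norm ((deriv ^^ j) (mellin_barnes n lam) (cis \<theta> * of_real x)) \<le> K * x powr (- ((real n - 1) / 2)) * exp (- real n * cos \<theta> * x)"
proof -
  define s where "s = sin (pi / n)"
  have s: "s > 0" "s \<le> 1" using sin_pi_frac_pos[of 1 n] n by (simp_all add: s_def)
  \<comment> \<open>On the disc |Im z| \<le> 2 x and Re z \<ge> x s / 2, so their quotient is at
    most 4 / s.\<close>
  define \<theta>0 where "\<theta>0 = arctan (4 / s)"
  have \<theta>0: "0 \<le> \<theta>0" "\<theta>0 < pi / 2" using s arctan_ubound by (auto simp: \<theta>0_def)
  have n1: "n \<ge> 1" using n by simp
  obtain K where K: "K > 0" "\<And>lam z. (\<Sum>l=1..n. lam l) = 0 \<Longrightarrow> Re z \<ge> 5 * (max_norm n lam + 1)\<^sup>2 \<Longrightarrow> \<bar>Im (Ln z)\<bar> \<le> \<theta>0 \<Longrightarrow>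
     norm (mellin_barnes n lam z) \<le> K * Re z powr (- ((real n - 1) / 2)) * exp (- real n * Re z)"
    using mellin_barnes_bound[OF n1 \<theta>0] by blast
  define K' where "K' = fact j * (K * (s / 2) powr (- ((real n - 1) / 2)) * exp (real n / 2)) / (1/2) ^ j"
  have "K' > 0" using K s by (simp add: K'_def)
  moreover have "norm ((deriv ^^ j) (mellin_barnes n lam) (cis \<theta> * of_real x)) \<le> K' * x powr (- ((real n - 1) / 2)) * exp (- real n * cos \<theta> * x)"
    if sum0: "(\<Sum>l=1..n. lam l) = 0" and x: "x * s \<ge> 10 * (max_norm n lam + 1)\<^sup>2" and \<theta>: "\<bar>\<theta>\<bar> < pi / 2" "s \<le> cos \<theta>" for lam x \<theta>
  proof -
    have "max_norm n lam + 1 \<ge> 1" using max_norm_nonneg[OF n1] by simp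
    then have C: "(max_norm n lam + 1)\<^sup>2 \<ge> 1" by (simp add: one_le_power)
    have xs: "x * s \<ge> 10" using x C by linarith
    then have x0: "x > 0" using s by (meson less_le_trans not_less zero_less_numeral mult_nonpos_nonneg le_less leD)
    have "x * s \<le> x" using x0 s by (simp add: mult_left_le)
    then have x1: "x \<ge> 10" using xs by linarith
    have Rz: "cos \<theta> * x \<ge> x * s" using x0 \<theta>(2) by (simp add: mult.commute mult_left_mono)
    define z0 where "z0 = cis \<theta> * of_real x"
    \<comment> \<open>Two lower bounds for Re z: the exponential tolerates only an additive loss,
      whereas for the power a loss by a constant factor is harmless.\<close>
    have pt: "Re z \<ge> x * s / 2 \<and> Re z \<ge> cos \<theta> * x - 1/2 \<and> \<bar>Im (Ln z)\<bar> \<le> \<theta>0" if "norm (z0 - z) \<le> 1/2" for z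
    proof -
      have "\<bar>Re z0 - Re z\<bar> \<le> 1/2" "\<bar>Im z0 - Im z\<bar> \<le> 1/2"
        using that abs_Re_le_cmod[of "z0 - z"] abs_Im_le_cmod[of "z0 - z"] by auto
      moreover have "Re z0 = cos \<theta> * x" "\<bar>Im z0\<bar> \<le> x" 
        using x0 by (auto simp: z0_def abs_mult mult_left_le_one_le)
      ultimately have 1: "Re z \<ge> cos \<theta> * x - 1/2" "\<bar>Im z\<bar> \<le> x + 1/2" by linarith+
      then have 2: "Re z \<ge> x * s / 2" using Rz xs by linarith
      then have 3: "Re z > 0" using xs by linarith
      have "\<bar>Im z\<bar> \<le> 2 * x" using 1 x1 by linarith
      also have "2 * x = (4 / s) * (x * s / 2)" using s by (simp add: field_simps)
      also have "\<dots> \<le> (4 / s) * Re z" using 2 s by (intro mult_left_mono) auto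
      finally have "\<bar>Im z\<bar> / Re z \<le> 4 / s" using 3 by (simp add: divide_le_eq)
      then have "\<bar>Im z / Re z\<bar> \<le> 4 / s" using 3 by (simp add: abs_divide)
      then have "arctan \<bar>Im z / Re z\<bar> \<le> \<theta>0" unfolding \<theta>0_def by (simp only: arctan_le_iff)
      moreover have "\<bar>arctan (Im z / Re z)\<bar> = arctan \<bar>Im z / Re z\<bar>" by (simp add: abs_if arctan_minus)
      moreover have "Im (Ln z) = arctan (Im z / Re z)" using 3 by (metis Arg_eq_Im_Ln arg_conv_arctan order_less_irrefl zero_complex.simps(1))
      ultimately have "\<bar>Im (Ln z)\<bar> \<le> \<theta>0" by simp
      then show ?thesis using 1 2 by auto
    qed
    have "norm ((deriv ^^ j) (mellin_barnes n lam) z0) \<le> 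
       fact j * (K * (x * s / 2) powr (- ((real n - 1) / 2)) * exp (- real n * (cos \<theta> * x - 1/2))) / (1/2) ^ j"
    proof (rule Cauchy_inequality)
      have sub: "cball z0 (1/2) \<subseteq> {z. Re z > 0}"
      proof
        fix z assume "z \<in> cball z0 (1/2)"
        then have "norm (z0 - z) \<le> 1/2" by (simp add: dist_norm)
        then have "Re z \<ge> x * s / 2" using pt by blast
        then show "z \<in> {z. Re z > 0}" using xs by simp
      qed
      have hol: "mellin_barnes n lam holomorphic_on cball z0 (1/2)"
        using holomorphic_mellin_barnes[OF n1] sub by (rule holomorphic_on_subset)
      then show "mellin_barnes n lam holomorphic_on ball z0 (1/2)" using ball_subset_cball holomorphic_on_subset by blast
      show "continuous_on (cball z0 (1/2)) (mellin_barnes n lam)" using hol by (rule holomorphic_on_imp_continuous_on)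
      fix z assume "norm (z0 - z) = 1/2"
      then have z: "Re z \<ge> x * s / 2" "Re z \<ge> cos \<theta> * x - 1/2" "\<bar>Im (Ln z)\<bar> \<le> \<theta>0" using pt[of z] by auto
      have "norm (mellin_barnes n lam z) \<le> K * Re z powr (- ((real n - 1) / 2)) * exp (- real n * Re z)"
        using x z by (intro K sum0) auto
      also have "\<dots> \<le> K * (x * s / 2) powr (- ((real n - 1) / 2)) * exp (- real n * (cos \<theta> * x - 1/2))"
        using z xs K(1) n1 by (intro mult_mono powr_mono2') (auto intro!: mult_left_mono)
      finally show "norm (mellin_barnes n lam z) \<le> K * (x * s / 2) powr (- ((real n - 1) / 2)) * exp (- real n * (cos \<theta> * x - 1/2))" .
    qed simp
    also have "\<dots> = K' * x powr (- ((real n - 1) / 2)) * exp (- real n * cos \<theta> * x)"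
    proof -
      have "(x * s / 2) powr (- ((real n - 1) / 2)) = x powr (- ((real n - 1) / 2)) * (s / 2) powr (- ((real n - 1) / 2))"
        using powr_mult[of x "s / 2"] x0 s by simp
      moreover have "exp (- real n * (cos \<theta> * x - 1/2)) = exp (real n / 2) * exp (- real n * cos \<theta> * x)"
        by (simp add: mult_exp_exp algebra_simps)
      ultimately show ?thesis by (simp add: K'_def)
    qed
    finally show ?thesis by (simp add: z0_def)
  qed
  ultimately show ?thesis unfolding s_def by blast
qed

section \<open>Comparison of the exponents\<close>

lemma Lambda_sum_eq:
  assumes "\<forall>l\<in>{1..n}. sg l = 1 \<or> sg l = -1" "(\<Sum>l=1..n. lam l) = 0"
  shows "Lambda_sum 1 n sg lam = Lambda_sum (-1) n sg lam"
  using sum_sign_set(2)[OF assms(1), of lam] assms(2) by (simp add: Lambda_sum_def minus_unique)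

lemma I_sin_eq:
  assumes "\<forall>l\<in>{1..n}. sg l = 1 \<or> sg l = -1" "n \<ge> 1"
  shows "I_sin 1 n sg = I_sin (-1) n sg"
proof -
  have "real (card (sign_set n (-1) sg)) = real n - real (card (sign_set n 1 sg))"
    using card_sign_set_add[OF assms(1)] by linarith
  then have "real (card (sign_set n (-1) sg)) / real n = 1 - real (card (sign_set n 1 sg)) / real n"
    using assms(2) by (simp add: diff_divide_distrib)
  then have "real (card (sign_set n (-1) sg)) / real n * pi = pi - real (card (sign_set n 1 sg)) / real n * pi"
    by (simp only: left_diff_distrib mult_1)
  then show ?thesis unfolding I_sin_def by (simp only: sin_pi_minus)
qed

lemma max_Im_ge: "l \<in> {1..n} \<Longrightarrow> \<bar>Im (lam l)\<bar> \<le> max_Im n lam"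
  unfolding max_Im_def by (intro Max_ge) auto

text \<open>If both signs occur at least twice, then \<open>- \<pi> Im \<Lambda>\<close> may exceed \<open>\<pi> max \<bar>Im \<lambda>\<^sub>l\<bar>\<close>; the gap between
  \<open>sin (2\<pi>/n)\<close> and \<open>sin (\<pi>/n)\<close> makes up for this when \<open>x\<close> is large.\<close>

lemma exponent_le:
  assumes n: "n \<ge> 2" and sg: "\<forall>l\<in>{1..n}. sg l = 1 \<or> sg l = -1" and sum0: "(\<Sum>l=1..n. lam l) = 0"
    and pq: "0 < card (sign_set n 1 sg)" "0 < card (sign_set n (-1) sg)" and x: "x \<ge> 0"
    and large: "n \<ge> 4 \<Longrightarrow> x * (sin (2 / real n * pi) - sin (1 / real n * pi)) \<ge> pi * (max_norm n lam + 1)\<^sup>2"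
  shows "- pi * Im (Lambda_sum 1 n sg lam) - real n * I_sin 1 n sg * x \<le> pi * max_Im n lam - real n * sin (1 / real n * pi) * x"
proof -
  define p q where "p = card (sign_set n 1 sg)" and "q = card (sign_set n (-1) sg)"
  have pqn: "p + q = n" "p \<ge> 1" "q \<ge> 1" using card_sign_set_add[OF sg] pq by (auto simp: p_def q_def)
  have I: "I_sin 1 n sg = sin (real p / real n * pi)" by (simp add: I_sin_def p_def)
  show ?thesis
  proof (cases "p = 1 \<or> q = 1")
    case True
    \<comment> \<open>A sign that occurs once makes \<Lambda> equal to \<plusminus> a single shift,
      read off from the upper or the lower form of \<Lambda>.\<close>
    have "\<exists>l\<in>{1..n}. \<bar>Im (Lambda_sum 1 n sg lam)\<bar> = \<bar>Im (lam l)\<bar>"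
    proof (cases "p = 1")
      case True
      then obtain l where "sign_set n 1 sg = {l}" unfolding p_def using card_1_singletonE by blast
      then have "l \<in> {1..n}" "Lambda_sum 1 n sg lam = - lam l" by (auto simp: sign_set_def Lambda_sum_def)
      then show ?thesis by (intro bexI[of _ l]) simp_all
    next
      case False
      then have "q = 1" using True by auto
      then obtain l where "sign_set n (-1) sg = {l}" unfolding q_def using card_1_singletonE by blast
      then have "l \<in> {1..n}" "Lambda_sum (-1) n sg lam = lam l" by (auto simp: sign_set_def Lambda_sum_def)
      then show ?thesis unfolding Lambda_sum_eq[OF sg sum0] by (intro bexI[of _ l]) simp_all
    qed
    then have "\<bar>Im (Lambda_sum 1 n sg lam)\<bar> \<le> max_Im n lam" using max_Im_ge[of _ n lam] by auto
    then have "- Im (Lambda_sum 1 n sg lam) \<le> max_Im n lam" by linarith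
    then have "pi * - Im (Lambda_sum 1 n sg lam) \<le> pi * max_Im n lam" by (intro mult_left_mono) auto
    moreover have "sin (real 1 / real n * pi) \<le> I_sin 1 n sg" unfolding I using pqn by (intro sin_pi_frac_ge) auto
    then have "real n * sin (1 / real n * pi) * x \<le> real n * I_sin 1 n sg * x" using x by (intro mult_right_mono mult_left_mono) auto
    ultimately show ?thesis by simp
  next
    case False
    then have pq2: "p \<ge> 2" "q \<ge> 2" "n \<ge> 4" using pqn by auto
    define C where "C = max_norm n lam + 1"
    have C: "C \<ge> 1" using max_norm_nonneg[of n lam] n by (simp add: C_def)
    have "norm (Lambda_sum 1 n sg lam) \<le> (\<Sum>l\<in>sign_set n 1 sg. norm (lam l))"
      by (simp add: Lambda_sum_def norm_sum)
    also have "\<dots> \<le> (\<Sum>l\<in>sign_set n 1 sg. C)"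
      by (intro sum_mono) (use max_norm_ge[of _ n lam] in \<open>force simp: C_def sign_set_def\<close>)
    also have "\<dots> = p * C" by (simp add: p_def)
    \<comment> \<open>This crude bound matches \<open>large\<close>: pi n C^2 is absorbed by n x
      times the gap between the two sines.\<close>
    also have "\<dots> \<le> n * C\<^sup>2" using pqn C by (intro mult_mono) (auto simp: power2_eq_square)
    finally have "- Im (Lambda_sum 1 n sg lam) \<le> n * C\<^sup>2" using abs_Im_le_cmod[of "Lambda_sum 1 n sg lam"] by linarith
    then have "pi * - Im (Lambda_sum 1 n sg lam) \<le> pi * (n * C\<^sup>2)" by (intro mult_left_mono) auto
    also have "\<dots> = n * (pi * C\<^sup>2)" by simp
    also have "\<dots> \<le> n * (x * (sin (2 / real n * pi) - sin (1 / real n * pi)))"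
      using large[OF pq2(3)] by (intro mult_left_mono) (auto simp: C_def)
    finally have 1: "pi * - Im (Lambda_sum 1 n sg lam) + real n * sin (1 / real n * pi) * x \<le> real n * sin (2 / real n * pi) * x" 
      by (simp add: algebra_simps)
    have "sin (real 2 / real n * pi) \<le> I_sin 1 n sg" unfolding I using pqn pq2 by (intro sin_pi_frac_ge) auto
    then have "real n * sin (2 / real n * pi) * x \<le> real n * I_sin 1 n sg * x" using x by (intro mult_right_mono mult_left_mono) auto
    moreover have "0 \<le> max_Im n lam" using max_Im_ge[of 1 n lam] n abs_ge_zero[of "Im (lam 1)"] by (auto intro: order_trans)
    then have "0 \<le> pi * max_Im n lam" by simp
    ultimately show ?thesis using 1 by simp
  qed
qed

text \<open>Two signs of each kind require n \<ge> 4, and this is also the range in which 2 pi / n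
  \<le> pi / 2, where the sine is increasing.\<close>

lemma sin_2_gt_sin_1: "n \<ge> 4 \<Longrightarrow> sin (1 / real n * pi) < sin (2 / real n * pi)"
proof (rule sin_monotone_2pi)
  assume n: "n \<ge> 4"
  then have "2 / real n \<le> 1 / 2" by (simp add: field_simps)
  then have "2 / real n * pi \<le> 1 / 2 * pi" by (intro mult_right_mono) auto
  then show "2 / real n * pi \<le> pi / 2" by simp
  show "1 / real n * pi < 2 / real n * pi" using n by (intro mult_strict_right_mono divide_strict_right_mono) auto
  have "0 \<le> 1 / real n * pi" by simp
  then show "- (pi / 2) \<le> 1 / real n * pi" using pi_ge_zero by linarith
qed

theorem proposition13p2:
  fixes n :: nat
  assumes "n \<ge> 2"
  shows "\<exists>c>0. \<forall>j. \<exists>K>0. \<forall>(lam :: nat \<Rightarrow> complex) (sg :: nat \<Rightarrow> int).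
    (\<Sum>l=1..n. lam l) = 0 \<and>
    (\<forall>l\<in>{1..n}. sg l = 1 \<or> sg l = -1) \<and>
    (\<exists>l\<in>{1..n}. \<exists>m\<in>{1..n}. sg l \<noteq> sg m) \<longrightarrow>
      Lambda_sum 1 n sg lam = Lambda_sum (-1) n sg lam \<and>
      I_sin 1 n sg = I_sin (-1) n sg \<and>
      I_sin 1 n sg > 0 \<and>
      (\<forall>\<gamma> x. bessel_contour n lam \<gamma> \<and> x \<ge> c * (max_norm n lam + 1)^2 \<longrightarrow>
         norm (nth_derivative j (bessel_J n sg lam \<gamma>) x)
           \<le> K * x powr (- ((real n - 1) / 2)) *
              exp (- pi * Im (Lambda_sum 1 n sg lam) - real n * I_sin 1 n sg * x) \<and>
         norm (nth_derivative j (bessel_J n sg lam \<gamma>) x)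
           \<le> K * x powr (- ((real n - 1) / 2)) *
              exp (pi * max_Im n lam - real n * sin (1 / real n * pi) * x))"
proof -
  define s d where "s = sin (pi / n)" and "d = sin (2 / real n * pi) - sin (1 / real n * pi)"
  have s: "s > 0" using sin_pi_frac_pos[of 1 n] assms by (simp add: s_def)
  have n1: "n \<ge> 1" using assms by simp
  \<comment> \<open>The first term meets the condition of \<open>mellin_barnes_deriv_bound\<close>,
    the second the condition \<open>large\<close> of \<open>exponent_le\<close>, which arises only
    for n \<ge> 4. Neither involves j.\<close>
  define c where "c = 10 / s + (if n \<ge> 4 then pi / d else 0)"
  have d: "d > 0" if "n \<ge> 4" using sin_2_gt_sin_1[OF that] by (simp add: d_def)
  have c10: "c \<ge> 10 / s" using d by (auto simp: c_def)
  have c: "c > 0" using c10 s by (meson divide_pos_pos less_le_trans zero_less_numeral)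
  have cd: "c \<ge> pi / d" if "n \<ge> 4" using that s by (simp add: c_def)
  show ?thesis
  proof (rule exI[of _ c], intro conjI c allI)
    fix j
    obtain K where K: "K > 0" "\<And>lam x \<theta>. (\<Sum>l=1..n. lam l) = 0 \<Longrightarrow> x * s \<ge> 10 * (max_norm n lam + 1)\<^sup>2 \<Longrightarrow> \<bar>\<theta>\<bar> < pi / 2 \<Longrightarrow> s \<le> cos \<theta> \<Longrightarrow>
       norm ((deriv ^^ j) (mellin_barnes n lam) (cis \<theta> * of_real x)) \<le> K * x powr (- ((real n - 1) / 2)) * exp (- real n * cos \<theta> * x)"
      using mellin_barnes_deriv_bound[OF assms, of j] unfolding s_def[symmetric] by blast
    show "\<exists>K>0. \<forall>(lam :: nat \<Rightarrow> complex) (sg :: nat \<Rightarrow> int).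
    (\<Sum>l=1..n. lam l) = 0 \<and>
    (\<forall>l\<in>{1..n}. sg l = 1 \<or> sg l = -1) \<and>
    (\<exists>l\<in>{1..n}. \<exists>m\<in>{1..n}. sg l \<noteq> sg m) \<longrightarrow>
      Lambda_sum 1 n sg lam = Lambda_sum (-1) n sg lam \<and>
      I_sin 1 n sg = I_sin (-1) n sg \<and>
      I_sin 1 n sg > 0 \<and>
      (\<forall>\<gamma> x. bessel_contour n lam \<gamma> \<and> x \<ge> c * (max_norm n lam + 1)^2 \<longrightarrow>
         norm (nth_derivative j (bessel_J n sg lam \<gamma>) x)
           \<le> K * x powr (- ((real n - 1) / 2)) *
              exp (- pi * Im (Lambda_sum 1 n sg lam) - real n * I_sin 1 n sg * x) \<and>
         norm (nth_derivative j (bessel_J n sg lam \<gamma>) x)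
           \<le> K * x powr (- ((real n - 1) / 2)) *
              exp (pi * max_Im n lam - real n * sin (1 / real n * pi) * x))"
    proof (rule exI[of _ K], intro conjI K allI impI; (elim conjE)?)
      fix lam :: "nat \<Rightarrow> complex" and sg :: "nat \<Rightarrow> int"
      assume sum0: "(\<Sum>l=1..n. lam l) = 0" and sg: "\<forall>l\<in>{1..n}. sg l = 1 \<or> sg l = -1" and mixed: "\<exists>l\<in>{1..n}. \<exists>m\<in>{1..n}. sg l \<noteq> sg m"
      define p where "p = card (sign_set n 1 sg)"
      have "sign_set n 1 sg \<noteq> {}" "sign_set n (-1) sg \<noteq> {}" using mixed sg unfolding sign_set_def by fastforce+
      then have pq: "0 < card (sign_set n 1 sg)" "0 < card (sign_set n (-1) sg)" by (simp_all add: card_gt_0_iff)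
      then have p: "0 < p" "p < n" using card_sign_set_add[OF sg] by (auto simp: p_def)
      show "Lambda_sum 1 n sg lam = Lambda_sum (-1) n sg lam" by (rule Lambda_sum_eq[OF sg sum0])
      show "I_sin 1 n sg = I_sin (-1) n sg" by (rule I_sin_eq[OF sg n1])
      show "I_sin 1 n sg > 0" using sin_pi_frac_pos[OF p] by (simp add: I_sin_def p_def)
      fix \<gamma> x assume \<gamma>: "bessel_contour n lam \<gamma>" and x: "x \<ge> c * (max_norm n lam + 1)^2"
      define C2 where "C2 = (max_norm n lam + 1)\<^sup>2"
      have C2: "C2 \<ge> 1" using max_norm_nonneg[OF n1, of lam] by (simp add: C2_def one_le_power)
      have xc: "x \<ge> c' * C2" if "c \<ge> c'" for c'
        using x mult_right_mono[OF that, of C2] C2 by (simp add: C2_def)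
      have x0: "x > 0" using xc[OF order_refl] c C2 by (smt (verit) mult_pos_pos)
      have xs: "x * s \<ge> 10 * C2" using xc[OF c10] s by (simp add: field_simps)
      define \<theta> where "\<theta> = pi / 2 - pi * p / n"
      have "0 < pi * p / n" "pi * p / n < pi" using p by (auto simp: divide_less_eq)
      then have \<theta>: "\<bar>\<theta>\<bar> < pi / 2" unfolding \<theta>_def abs_less_iff by linarith
      have "cos \<theta> = sin (pi * p / n)" by (simp add: \<theta>_def cos_diff)
      then have cosI: "cos \<theta> = I_sin 1 n sg" by (simp add: I_sin_def p_def mult.commute)
      have "sin (real 1 / real n * pi) \<le> sin (real p / real n * pi)" using p by (intro sin_pi_frac_ge) auto
      then have sle: "s \<le> cos \<theta>" unfolding cosI by (simp add: s_def I_sin_def p_def)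
      have Re\<omega>: "Re (cis \<theta>) > 0" using sle s by simp
      define E where "E = exp (\<i> * of_real pi * Lambda_sum 1 n sg lam)"
      have "nth_derivative j (bessel_J n sg lam \<gamma>) x = E * cis \<theta> ^ j * (deriv ^^ j) (mellin_barnes n lam) (cis \<theta> * of_real x)"
      proof (rule nth_derivative_ray[OF holomorphic_mellin_barnes[OF n1] Re\<omega> _ x0])
        \<comment> \<open>The identity is established for every y > 0, not only above the threshold,
          as differentiation at x needs it in a neighbourhood.\<close>
        show "bessel_J n sg lam \<gamma> y = E * mellin_barnes n lam (cis \<theta> * of_real y)" if "y > 0" for y
          unfolding E_def by (rule bessel_J_eq_mellin_barnes[OF n1 sg sum0 _ \<theta> \<gamma> that]) (simp add: \<theta>_def p_def)
      qed
      then have "norm (nth_derivative j (bessel_J n sg lam \<gamma>) x) = norm E * norm ((deriv ^^ j) (mellin_barnes n lam) (cis \<theta> * of_real x))"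
        by (simp add: norm_mult norm_power)
      also have "norm E = exp (- pi * Im (Lambda_sum 1 n sg lam))" by (simp add: E_def)
      also have "exp (- pi * Im (Lambda_sum 1 n sg lam)) * norm ((deriv ^^ j) (mellin_barnes n lam) (cis \<theta> * of_real x))
         \<le> exp (- pi * Im (Lambda_sum 1 n sg lam)) * (K * x powr (- ((real n - 1) / 2)) * exp (- real n * cos \<theta> * x))"
        using xs by (intro mult_left_mono K(2) sum0 \<theta> sle) (auto simp: C2_def)
      also have "\<dots> = K * x powr (- ((real n - 1) / 2)) * exp (- pi * Im (Lambda_sum 1 n sg lam) - real n * I_sin 1 n sg * x)"
        by (simp add: cosI mult_exp_exp)
      finally show main: "norm (nth_derivative j (bessel_J n sg lam \<gamma>) x) \<le> K * x powr (- ((real n - 1) / 2)) *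
              exp (- pi * Im (Lambda_sum 1 n sg lam) - real n * I_sin 1 n sg * x)" .
      also have "\<dots> \<le> K * x powr (- ((real n - 1) / 2)) * exp (pi * max_Im n lam - real n * sin (1 / real n * pi) * x)"
      proof (intro mult_left_mono iffD2[OF exp_le_cancel_iff] exponent_le[OF assms sg sum0 pq])
        assume n4: "n \<ge> 4"
        have "pi * C2 \<le> x * d" using xc[OF cd[OF n4]] d[OF n4] by (simp add: field_simps)
        then show "pi * (max_norm n lam + 1)\<^sup>2 \<le> x * (sin (2 / real n * pi) - sin (1 / real n * pi))" by (simp add: C2_def d_def)
      qed (use x0 K(1) in auto)
      finally show "norm (nth_derivative j (bessel_J n sg lam \<gamma>) x) \<le> K * x powr (- ((real n - 1) / 2)) *
              exp (pi * max_Im n lam - real n * sin (1 / real n * pi) * x)" .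
    qed
  qed
qed

end
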